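(* We have $$A^{2134}(x,q)=1+I^{2134}(x,q)+x\left(A^{2134}(x,q)-1\right)+\frac{x}{1-xq}\left(I^{213}(x,q)-x\right).$$ Moreover, $$I^{2134}(x)=(1-x)E(x)-xC(x)-1+2x+\frac{x^2}{1-x},$$ $I^{2134}_1=1$, and for $n\ge2$, $$I^{2134}_n=E_n-E_{n-1}-C_{n-1}+1,$$ where $C_m=\frac1{m+1}\binom{2m}m$ is the $m$-th Catalan number, $C(x)=\sum_{m\ge0}C_mx^m=\frac{1-\sqrt{1-4x}}{2x}$, $E_m$ is the number of $1234$-avoiding permutations of $[m]$ ($E_0=1$) and $E(x)=\sum_{m\ge0}E_mx^m$.
   Context: For a permutation $\pi=\pi_1\cdots\pi_n$ of $[n]$, let $i_\pi$ be the smallest index $i$ with $\{\pi_1,\dots,\pi_i\}=\{1,\dots,i\}$; $\pi$ is indecomposable if $i_\pi=n$ (the empty permutation is not indecomposable). A permutation $\pi$ avoids a pattern $\tau\in\mathfrak S_k$ if no subsequence $\pi_{j_1}\cdots\pi_{j_k}$ ($j_1<\cdots<j_k$) is order-isomorphic to $\tau$. A descent of $\pi$ is an index $i$ with $\pi_i>\pi_{i+1}$. For a pattern $\sigma$, $A^\sigma_{n,i}$ (resp. $I^\sigma_{n,i}$) is the number of $\sigma$-avoiding permutations (resp. $\sigma$-avoiding indecomposable permutations) of $[n]$ with $i$ descents; $A^\sigma(x,q)=1+\sum_{n\ge1}\sum_iA^\sigma_{n,i}x^nq^i$, $I^\sigma(x,q)=\sum_{n\ge1}\sum_iI^\sigma_{n,i}x^nq^i$,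 $I^\sigma(x)=I^\sigma(x,1)=\sum_{n\ge1}I^\sigma_nx^n$. It is known that $1234$ and $2134$ are Wilf-equivalent, i.e. $E_m$ also equals the number of $2134$-avoiding permutations of $[m]$. *)

theory Defs
  imports
    "HOL-Computational_Algebra.Computational_Algebra"
    "HOL-Combinatorics.Multiset_Permutations"
    "HOL-Library.Sublist"
begin

text \<open>
  A permutation \<open>\<pi>\<^sub>1 \<cdots> \<pi>\<^sub>n\<close> of \<open>[n]\<close> is the list of its values, an element of
  \<open>permutations_of_set {1..n}\<close>. Values start at 1, list positions at 0.
\<close>

definition order_isomorphic :: "nat list \<Rightarrow> nat list \<Rightarrow> bool" where
  "order_isomorphic xs ys \<longleftrightarrow> length xs = length ys \<and>
     (\<forall>a < length xs. \<forall>b < length xs. xs ! a < xs ! b \<longleftrightarrow> ys ! a < ys ! b)"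

definition avoids :: "nat list \<Rightarrow> nat list \<Rightarrow> bool" where
  "avoids p \<tau> \<longleftrightarrow> \<not> (\<exists>s. subseq s p \<and> order_isomorphic s \<tau>)"

definition num_descents :: "nat list \<Rightarrow> nat" where
  "num_descents p = card {i. Suc i < length p \<and> p ! i > p ! Suc i}"

definition first_component :: "nat list \<Rightarrow> nat" where
  "first_component p = (LEAST i. 1 \<le> i \<and> set (take i p) = {1..i})"

definition indecomposable :: "nat list \<Rightarrow> bool" where
  "indecomposable p \<longleftrightarrow> p \<noteq> [] \<and> first_component p = length p"

definition A_num :: "nat list \<Rightarrow> nat \<Rightarrow> nat \<Rightarrow> nat" where
  "A_num \<sigma> n i = card {p \<in> permutations_of_set {1..n}. avoids p \<sigma> \<and> num_descents p = i}"

definition I_num :: "nat list \<Rightarrow> nat \<Rightarrow> nat \<Rightarrow> nat" where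
  "I_num \<sigma> n i = card {p \<in> permutations_of_set {1..n}.
     avoids p \<sigma> \<and> indecomposable p \<and> num_descents p = i}"

text \<open>
  Series in \<open>x\<close> and \<open>q\<close> have type \<open>real fps fps\<close>: \<open>x\<close> is the outer variable and
  \<open>q\<close> the variable of the coefficient ring, so the coefficient of \<open>x\<^sup>n q\<^sup>i\<close> in
  \<open>F\<close> is \<open>F $ n $ i\<close>.
\<close>

abbreviation var_x :: "real fps fps" where
  "var_x \<equiv> fps_X"

abbreviation var_q :: "real fps fps" where
  "var_q \<equiv> fps_const fps_X"

definition A_gf :: "nat list \<Rightarrow> real fps fps" where
  "A_gf \<sigma> = 1 + Abs_fps (\<lambda>n. if n = 0 then 0 else Abs_fps (\<lambda>i. of_nat (A_num \<sigma> n i)))"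

definition I_gf :: "nat list \<Rightarrow> real fps fps" where
  "I_gf \<sigma> = Abs_fps (\<lambda>n. if n = 0 then 0 else Abs_fps (\<lambda>i. of_nat (I_num \<sigma> n i)))"

text \<open>
  Setting \<open>q = 1\<close> sums the coefficients over all \<open>i\<close>. A permutation of \<open>[n]\<close> with
  \<open>n \<ge> 1\<close> has at most \<open>n - 1\<close> descents, so \<open>i < n\<close> covers every nonzero term
  (lemma \<open>I_tot_eq_card\<close>).
\<close>

definition I_tot :: "nat list \<Rightarrow> nat \<Rightarrow> nat" where
  "I_tot \<sigma> n = (\<Sum>i<n. I_num \<sigma> n i)"

definition I_gf1 :: "nat list \<Rightarrow> real fps" where
  "I_gf1 \<sigma> = Abs_fps (\<lambda>n. if n = 0 then 0 else of_nat (I_tot \<sigma> n))"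

definition E_num :: "nat \<Rightarrow> nat" where
  "E_num m = card {p \<in> permutations_of_set {1..m}. avoids p [1, 2, 3, 4]}"

definition E_gf :: "real fps" where
  "E_gf = Abs_fps (\<lambda>m. of_nat (E_num m))"

definition catalan_num :: "nat \<Rightarrow> real" where
  "catalan_num m = 1 / (of_nat m + 1) * of_nat ((2 * m) choose m)"

definition catalan_gf :: "real fps" where
  "catalan_gf = Abs_fps catalan_num"

lemma num_descents_less:
  assumes "p \<noteq> []"
  shows "num_descents p < length p"
proof -
  have "num_descents p \<le> card {..<length p - 1}"
    unfolding num_descents_def by (rule card_mono) auto
  also have "\<dots> < length p"
    using assms by simp
  finally show ?thesis .
qed

lemma I_tot_eq_card:
  "I_tot \<sigma> n = card {p \<in> permutations_of_set {1..n}. avoids p \<sigma> \<and> indecomposable p}"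
    (is "_ = card ?S")
proof -
  have fin: "finite ?S" by simp
  have "num_descents p \<in> {..<n}" if "p \<in> ?S" for p
  proof -
    have "length p = n"
      using that length_finite_permutations_of_set[of p "{1..n}"] by simp
    moreover have "p \<noteq> []"
      using that by (simp add: indecomposable_def)
    ultimately show ?thesis
      using num_descents_less by auto
  qed
  then have "num_descents ` ?S \<subseteq> {..<n}" by blast
  from sum.group[OF fin finite_lessThan this, of "\<lambda>_. 1::nat"]
  have "card ?S = (\<Sum>i<n. card {p \<in> ?S. num_descents p = i})"
    by simp
  also have "\<dots> = I_tot \<sigma> n"
    unfolding I_tot_def I_num_def
    by (intro sum.cong refl arg_cong[where f = card]) auto
  finally show ?thesis by simp
qed

end

theory Submission
  imports Defs
begin

text \<open>
  Split a permutation after its first component, \<open>\<pi> = \<sigma> \<oplus> \<tau>\<close> with \<open>\<sigma>\<close> indecomposable. If \<open>\<sigma> = 1\<close>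
  and \<open>\<tau> \<noteq> \<epsilon>\<close>, then \<open>\<pi>\<close> avoids 2134 iff \<open>\<tau>\<close> does. A longer \<open>\<sigma>\<close> contains 21, so for
  nonempty \<open>\<tau>\<close> avoidance of 2134 means that \<open>\<sigma>\<close> avoids 213 and \<open>\<tau>\<close> is decreasing, which
  contributes the factor \<open>x / (1 - x q)\<close>. The same splitting of 213-avoiders leaves only \<open>\<sigma> = 1\<close>
  and the indecomposable ones, so that at \<open>q = 1\<close> the sum over \<open>\<sigma>\<close> telescopes to Catalan numbers.

  The Wilf equivalence of 1234 and 2134 goes through 1243, the reverse complement of 2134:
  inserting a new maximum into 1234-avoiders and into 1243-avoiders yields isomorphic
  generating trees, with the rule \<open>(x, y) \<mapsto> (x + 1, y + 1), (2, y + 1), \<dots>, (x, y + 1),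
  (x, x + 1), \<dots>, (x, y)\<close>, where \<open>x\<close> counts the insertion sites preceded by no ascending
  pair and \<open>y\<close> all admissible sites.
\<close>

section \<open>Patterns and descents\<close>

text \<open>Peeling off first letters reduces isomorphism with a concrete pattern to finitely many
  comparisons that the simplifier can evaluate. Both directions of each comparison appear because
  the definition ranges over ordered pairs of positions.\<close>

lemma order_isomorphic_Cons_Cons_iff:
  "order_isomorphic (x # xs) (y # ys) \<longleftrightarrow> order_isomorphic xs ys \<and>
     list_all2 (\<lambda>x' y'. (x < x' \<longleftrightarrow> y < y') \<and> (x' < x \<longleftrightarrow> y' < y)) xs ys"
  by (auto simp: order_isomorphic_def All_less_Suc2 list_all2_conv_all_nth)

lemma order_isomorphic_Nil_iff:
  "order_isomorphic [] ys \<longleftrightarrow> ys = []" "order_isomorphic xs [] \<longleftrightarrow> xs = []"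
  by (auto simp: order_isomorphic_def)

lemmas order_isomorphic_iffs = order_isomorphic_Cons_Cons_iff order_isomorphic_Nil_iff

lemma order_isomorphic_length: "order_isomorphic xs ys \<Longrightarrow> length xs = length ys"
  by (simp add: order_isomorphic_def)

text \<open>This lemma and its analogues below turn a pattern into a chain of strict inequalities
  that lists the letters of the subsequence by increasing value; for 2134 the chain is
  \<open>b < a\<close>, \<open>a < c\<close>, \<open>c < d\<close>.\<close>

lemma avoids_12_iff:
  "avoids p [1, 2] \<longleftrightarrow> (\<forall>a b. subseq [a, b] p \<longrightarrow> \<not> (a < b))"
proof -
  have *: "order_isomorphic [a, b] [1, 2] \<longleftrightarrow> a < b" for a b
    by (simp add: order_isomorphic_iffs) (rule iffI; (elim conjE)?; (intro conjI)?; simp)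
  have "\<exists>a b. s = [a, b]" if "order_isomorphic s [1, 2]" for s
    using order_isomorphic_length[OF that] by (auto simp: length_Suc_conv)
  then show ?thesis
    unfolding avoids_def using * by metis
qed

lemma avoids_123_iff:
  "avoids p [1, 2, 3] \<longleftrightarrow> (\<forall>a b c. subseq [a, b, c] p \<longrightarrow> \<not> (a < b \<and> b < c))"
proof -
  have *: "order_isomorphic [a, b, c] [1, 2, 3] \<longleftrightarrow> a < b \<and> b < c" for a b c
    by (simp add: order_isomorphic_iffs) (rule iffI; (elim conjE)?; (intro conjI)?; simp)
  have "\<exists>a b c. s = [a, b, c]" if "order_isomorphic s [1, 2, 3]" for s
    using order_isomorphic_length[OF that] by (auto simp: length_Suc_conv)
  then show ?thesis
    unfolding avoids_def using * by metis
qed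

lemma avoids_213_iff:
  "avoids p [2, 1, 3] \<longleftrightarrow> (\<forall>a b c. subseq [a, b, c] p \<longrightarrow> \<not> (b < a \<and> a < c))"
proof -
  have *: "order_isomorphic [a, b, c] [2, 1, 3] \<longleftrightarrow> b < a \<and> a < c" for a b c
    by (simp add: order_isomorphic_iffs) (rule iffI; (elim conjE)?; (intro conjI)?; simp)
  have "\<exists>a b c. s = [a, b, c]" if "order_isomorphic s [2, 1, 3]" for s
    using order_isomorphic_length[OF that] by (auto simp: length_Suc_conv)
  then show ?thesis
    unfolding avoids_def using * by metis
qed

lemma avoids_1234_iff:
  "avoids p [1, 2, 3, 4] \<longleftrightarrow> (\<forall>a b c d. subseq [a, b, c, d] p \<longrightarrow> \<not> (a < b \<and> b < c \<and> c < d))"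
proof -
  have *: "order_isomorphic [a, b, c, d] [1, 2, 3, 4] \<longleftrightarrow> a < b \<and> b < c \<and> c < d" for a b c d
    by (simp add: order_isomorphic_iffs) (rule iffI; (elim conjE)?; (intro conjI)?; simp)
  have "\<exists>a b c d. s = [a, b, c, d]" if "order_isomorphic s [1, 2, 3, 4]" for s
    using order_isomorphic_length[OF that] by (auto simp: length_Suc_conv)
  then show ?thesis
    unfolding avoids_def using * by metis
qed

lemma avoids_1243_iff:
  "avoids p [1, 2, 4, 3] \<longleftrightarrow> (\<forall>a b c d. subseq [a, b, c, d] p \<longrightarrow> \<not> (a < b \<and> b < d \<and> d < c))"
proof -
  have *: "order_isomorphic [a, b, c, d] [1, 2, 4, 3] \<longleftrightarrow> a < b \<and> b < d \<and> d < c" for a b c d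
    by (simp add: order_isomorphic_iffs) (rule iffI; (elim conjE)?; (intro conjI)?; simp)
  have "\<exists>a b c d. s = [a, b, c, d]" if "order_isomorphic s [1, 2, 4, 3]" for s
    using order_isomorphic_length[OF that] by (auto simp: length_Suc_conv)
  then show ?thesis
    unfolding avoids_def using * by metis
qed

lemma avoids_2134_iff:
  "avoids p [2, 1, 3, 4] \<longleftrightarrow> (\<forall>a b c d. subseq [a, b, c, d] p \<longrightarrow> \<not> (b < a \<and> a < c \<and> c < d))"
proof -
  have *: "order_isomorphic [a, b, c, d] [2, 1, 3, 4] \<longleftrightarrow> b < a \<and> a < c \<and> c < d" for a b c d
    by (simp add: order_isomorphic_iffs) (rule iffI; (elim conjE)?; (intro conjI)?; simp)
  have "\<exists>a b c d. s = [a, b, c, d]" if "order_isomorphic s [2, 1, 3, 4]" for s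
    using order_isomorphic_length[OF that] by (auto simp: length_Suc_conv)
  then show ?thesis
    unfolding avoids_def using * by metis
qed

lemma subseq_map_right_iff: "subseq xs (map f ys) \<longleftrightarrow> (\<exists>zs. subseq zs ys \<and> xs = map f zs)"
  by (auto simp: subseq_conv_nths nths_map)

lemma order_isomorphic_map:
  assumes "strict_mono f"
  shows "order_isomorphic (map f xs) ys \<longleftrightarrow> order_isomorphic xs ys"
  by (auto simp: order_isomorphic_def strict_mono_less[OF assms])

lemma avoids_map:
  assumes "strict_mono f"
  shows "avoids (map f p) \<tau> \<longleftrightarrow> avoids p \<tau>"
  by (auto simp: avoids_def subseq_map_right_iff order_isomorphic_map[OF assms])

lemma avoids_subseq: "avoids q \<tau> \<Longrightarrow> subseq p q \<Longrightarrow> avoids p \<tau>"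
  unfolding avoids_def using subseq_order.trans by blast

lemma num_descents_Cons_Cons:
  "num_descents (x # y # xs) = (if x > y then 1 else 0) + num_descents (y # xs)"
proof -
  let ?A = "\<lambda>p. {i. Suc i < length p \<and> p ! i > p ! Suc i}"
  have "?A (x # y # xs) = (if x > y then {0} else {}) \<union> Suc ` ?A (y # xs)"
  proof (intro set_eqI)
    fix i show "i \<in> ?A (x # y # xs) \<longleftrightarrow> i \<in> (if x > y then {0} else {}) \<union> Suc ` ?A (y # xs)"
      by (cases i) auto
  qed
  moreover have "finite (?A (y # xs))"
    by (rule finite_subset[of _ "{..length (y # xs)}"]) auto
  ultimately show ?thesis
    unfolding num_descents_def by (auto simp: card_image card_insert_if)
qed

lemma num_descents_short [simp]: "num_descents [] = 0" "num_descents [x] = 0"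
  by (auto simp: num_descents_def)

text \<open>The junction is an ascent, because every letter on its left is below every letter on its
  right.\<close>

lemma num_descents_append:
  assumes "\<And>x y. x \<in> set xs \<Longrightarrow> y \<in> set ys \<Longrightarrow> x < y"
  shows "num_descents (xs @ ys) = num_descents xs + num_descents ys"
  using assms
proof (induction xs rule: induct_list012)
  case (2 x)
  then show ?case
    by (cases ys) (auto simp: num_descents_Cons_Cons dest: order.asym)
qed (auto simp: num_descents_Cons_Cons)

lemma num_descents_map:
  assumes "strict_mono f"
  shows "num_descents (map f p) = num_descents p"
  unfolding num_descents_def
  by (rule arg_cong[where f = card]) (auto simp: strict_mono_less[OF assms])

lemma num_descents_rev_upt: "num_descents (rev [1..<Suc m]) = m - 1"
proof -
  have "{i. Suc i < length (rev [1..<Suc m]) \<and> rev [1..<Suc m] ! i > rev [1..<Suc m] ! Suc i} = {..<m - 1}"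
    by (auto simp: rev_nth simp del: upt_Suc)
  then show ?thesis
    unfolding num_descents_def by simp
qed

lemma avoids_12_Cons:
  "avoids (x # p) [1, 2] \<longleftrightarrow> (\<forall>y \<in> set p. y \<le> x) \<and> avoids p [1, 2]"
  unfolding avoids_12_iff 
  by (auto simp: subseq_singleton_left not_less)
    (metis subseq_Cons' subseq_singleton_left leD list_emb_Cons)+

lemma avoids_12_iff_sorted: "avoids p [1, 2] \<longleftrightarrow> sorted (rev p)"
proof (induction p)
  case Nil
  show ?case unfolding avoids_12_iff by simp
next
  case (Cons x p)
  then show ?case unfolding avoids_12_Cons by (auto simp: sorted_append)
qed

text \<open>Avoiding 12 means weakly decreasing, and a set has only one decreasing arrangement.
  Hence there is exactly one such permutation of each length.\<close>

lemma avoids_12_permutation_iff: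
  assumes "p \<in> permutations_of_set {1..m}"
  shows "avoids p [1, 2] \<longleftrightarrow> p = rev [1..<Suc m]"
proof -
  have "set p = set [1..<Suc m]" "distinct p"
    using assms by (auto dest: permutations_of_setD)
  then have "sorted (rev p) \<longleftrightarrow> rev p = [1..<Suc m]"
    using sorted_distinct_set_unique[of "rev p" "[1..<Suc m]"] 
    by (metis distinct_rev distinct_upt set_rev sorted_upt)
  then show ?thesis
    by (metis avoids_12_iff_sorted rev_swap)
qed

section \<open>Splitting off the first component\<close>

text \<open>This is the operation \<sigma> \<oplus> \<tau> of the overview.\<close>

definition direct_sum :: "nat list \<Rightarrow> nat list \<Rightarrow> nat list" where
  "direct_sum \<sigma> \<tau> = \<sigma> @ map ((+) (length \<sigma>)) \<tau>"

abbreviation indecomposables :: "nat \<Rightarrow> nat list set" where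
  "indecomposables n \<equiv> {p \<in> permutations_of_set {1..n}. indecomposable p}"

lemma length_permutation: "p \<in> permutations_of_set {1..n} \<Longrightarrow> length p = n"
  by (simp add: length_finite_permutations_of_set)

lemma strict_mono_plus_left: "strict_mono ((+) (k :: nat))"
  by (simp add: strict_mono_def)

lemma strict_mono_Suc: "strict_mono Suc"
  by (simp add: strict_mono_def)

lemma direct_sum_Nil [simp]: "direct_sum \<sigma> [] = \<sigma>"
  by (simp add: direct_sum_def)

text \<open>Used in both directions: to lift a permutation to a higher interval of values, and to
  standardise the block that remains after smaller values are removed.\<close>

lemma permutations_of_set_shift:
  "permutations_of_set {c + 1..c + k :: nat} = map ((+) c) ` permutations_of_set {1..k}"
  using permutations_of_set_image_inj[of "(+) c" "{1..k}"]
  by (simp add: image_add_atLeastAtMost add.commute)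

lemma direct_sum_permutation:
  assumes "\<sigma> \<in> permutations_of_set {1..k}" "\<tau> \<in> permutations_of_set {1..m}"
  shows "direct_sum \<sigma> \<tau> \<in> permutations_of_set {1..k + m}"
proof -
  have "set (map ((+) k) \<tau>) = {k + 1..k + m}"
    using assms(2) by (auto simp: permutations_of_set_def image_add_atLeastAtMost)
  then show ?thesis
    using assms length_permutation[OF assms(1)]
    by (auto simp: direct_sum_def permutations_of_set_def distinct_map simp del: set_map)
qed

lemma direct_sum_less:
  assumes "\<sigma> \<in> permutations_of_set {1..k}" "\<tau> \<in> permutations_of_set {1..m}"
    "x \<in> set \<sigma>" "y \<in> set (map ((+) (length \<sigma>)) \<tau>)"
  shows "x < y"
  using assms length_permutation[OF assms(1)] by (auto simp: permutations_of_set_def)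

lemma num_descents_direct_sum:
  assumes "\<sigma> \<in> permutations_of_set {1..k}" "\<tau> \<in> permutations_of_set {1..m}"
  shows "num_descents (direct_sum \<sigma> \<tau>) = num_descents \<sigma> + num_descents \<tau>"
  unfolding direct_sum_def
proof (subst num_descents_append)
  fix x y assume "x \<in> set \<sigma>" "y \<in> set (map ((+) (length \<sigma>)) \<tau>)"
  then show "x < y" by (rule direct_sum_less[OF assms])
qed (simp only: num_descents_map[OF strict_mono_plus_left])

text \<open>A prefix shorter than \<open>\<sigma>\<close> sees only letters of
  \<open>\<sigma>\<close>, so a smaller candidate index would contradict the minimality behind the
  indecomposability of \<open>\<sigma>\<close>.\<close>

lemma first_component_append:
  assumes "set \<sigma> = {1..length \<sigma>}" "indecomposable \<sigma>"
  shows "first_component (\<sigma> @ \<tau>) = length \<sigma>"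
  unfolding first_component_def
proof (rule Least_equality)
  show "1 \<le> length \<sigma> \<and> set (take (length \<sigma>) (\<sigma> @ \<tau>)) = {1..length \<sigma>}"
    using assms by (auto simp: indecomposable_def Suc_le_eq)
next
  fix i assume i: "1 \<le> i \<and> set (take i (\<sigma> @ \<tau>)) = {1..i}"
  show "length \<sigma> \<le> i"
  proof (rule ccontr)
    assume less: "\<not> length \<sigma> \<le> i"
    then have "first_component \<sigma> \<le> i"
      unfolding first_component_def using i by (intro Least_le) simp
    with less assms(2) show False
      by (simp add: indecomposable_def)
  qed
qed

text \<open>The cut is made at \<open>first_component p\<close>. The prefix holds the values up to
  \<open>k\<close>, so the rest holds the larger ones and becomes \<open>\<tau>\<close> after
  subtracting \<open>k\<close>. A smaller cut of the prefix would also be a cut of \<open>p\<close>.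
  The case \<open>k = n\<close> gives the empty \<open>\<tau>\<close>.\<close>

lemma permutation_decomposition:
  assumes "p \<in> permutations_of_set {1..n}" "1 \<le> n"
  obtains k \<sigma> \<tau> where "k \<in> {1..n}" "\<sigma> \<in> indecomposables k"
    "\<tau> \<in> permutations_of_set {1..n - k}" "p = direct_sum \<sigma> \<tau>"
proof -
  let ?P = "\<lambda>i. 1 \<le> i \<and> set (take i p) = {1..i}"
  define k where "k = first_component p"
  have len: "length p = n" and p: "set p = {1..n}" "distinct p"
    using assms(1) length_permutation by (auto dest: permutations_of_setD)
  then have "?P n"
    using assms(2) by simp
  then have k: "?P k" and kn: "k \<le> n"
    unfolding k_def first_component_def by (rule LeastI, rule Least_le)
  let ?\<sigma> = "take k p"
  have "length ?\<sigma> = k"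
    using kn len by simp
  moreover have "first_component ?\<sigma> = k"
    unfolding first_component_def
  proof (rule Least_equality)
    fix i assume i: "1 \<le> i \<and> set (take i ?\<sigma>) = {1..i}"
    show "k \<le> i"
    proof (rule ccontr)
      assume "\<not> k \<le> i"
      with i have "?P i" by (simp add: min_absorb1)
      then have "k \<le> i"
        unfolding k_def first_component_def by (rule Least_le)
      with \<open>\<not> k \<le> i\<close> show False ..
    qed
  qed (use k in simp)
  ultimately have \<sigma>: "?\<sigma> \<in> indecomposables k"
    using k p(2) by (auto simp: permutations_of_set_def indecomposable_def)
  have "set (take k p) \<inter> set (drop k p) = {}"
    using p(2) by (simp add: set_take_disj_set_drop_if_distinct)
  moreover have "set (take k p) \<union> set (drop k p) = set p"
    by (metis append_take_drop_id set_append)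
  ultimately have "set (drop k p) = {1..n} - {1..k}"
    using k p(1) by blast
  also have "\<dots> = {k + 1..n}"
    by auto
  finally have "set (drop k p) = {k + 1..n}" .
  then have "drop k p \<in> permutations_of_set {k + 1..k + (n - k)}"
    using p(2) kn by (simp add: permutations_of_set_def)
  then obtain \<tau> where \<tau>: "\<tau> \<in> permutations_of_set {1..n - k}" "drop k p = map ((+) k) \<tau>"
    unfolding permutations_of_set_shift by blast
  have "p = direct_sum ?\<sigma> \<tau>"
    unfolding direct_sum_def \<open>length ?\<sigma> = k\<close> \<tau>(2)[symmetric] by simp
  moreover have "k \<in> {1..n}"
    using k kn by simp
  ultimately show thesis
    using \<sigma> \<tau>(1) that by blast
qed

text \<open>The map from triples to direct sums is a bijection, since \<open>k\<close> is recovered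
  as the first component. The weight \<open>g\<close> is left general: powers of q by descents give
  the bivariate identity, and the constant 1 gives the counts.\<close>

lemma sum_permutations_first_component:
  assumes "1 \<le> n"
  shows "(\<Sum>p\<in>{p \<in> permutations_of_set {1..n}. Q p}. g p) =
    (\<Sum>k=1..n. \<Sum>\<sigma>\<in>indecomposables k.
       \<Sum>\<tau>\<in>{\<tau> \<in> permutations_of_set {1..n - k}. Q (direct_sum \<sigma> \<tau>)}. g (direct_sum \<sigma> \<tau>))"
proof -
  define T where "T k \<sigma> = {\<tau> \<in> permutations_of_set {1..n - k}. Q (direct_sum \<sigma> \<tau>)}" for k \<sigma>
  have fin: "finite (T k \<sigma>)" for k \<sigma>
    by (simp add: T_def)
  define D where "D = (SIGMA k:{1..n}. SIGMA \<sigma>:indecomposables k. T k \<sigma>)"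
  define f where "f = (\<lambda>(k :: nat, \<sigma>, \<tau>). direct_sum \<sigma> \<tau>)"
  have inj: "inj_on f D"
  proof (rule inj_onI, clarsimp simp: D_def f_def T_def)
    fix k \<sigma> \<tau> k' \<sigma>' \<tau>'
    assume \<sigma>: "\<sigma> \<in> permutations_of_set {Suc 0..k}" "indecomposable \<sigma>"
      and \<sigma>': "\<sigma>' \<in> permutations_of_set {Suc 0..k'}" "indecomposable \<sigma>'"
      and eq: "direct_sum \<sigma> \<tau> = direct_sum \<sigma>' \<tau>'"
    have len: "length \<sigma> = k" "length \<sigma>' = k'"
      using \<sigma> \<sigma>' length_permutation by auto
    have "first_component (direct_sum \<sigma> \<tau>) = k" "first_component (direct_sum \<sigma>' \<tau>') = k'"
      using \<sigma> \<sigma>' len unfolding direct_sum_def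
      by (subst first_component_append; auto dest: permutations_of_setD)+
    with eq have "k = k'" by simp
    with eq len show "k = k' \<and> \<sigma> = \<sigma>' \<and> \<tau> = \<tau>'"
      by (auto simp: direct_sum_def)
  qed
  have "f ` D = {p \<in> permutations_of_set {1..n}. Q p}"
  proof (intro equalityI subsetI)
    fix p assume "p \<in> f ` D"
    then obtain k \<sigma> \<tau> where "k \<in> {1..n}" "\<sigma> \<in> indecomposables k" "\<tau> \<in> T k \<sigma>" "p = direct_sum \<sigma> \<tau>"
      by (auto simp: D_def f_def)
    then show "p \<in> {p \<in> permutations_of_set {1..n}. Q p}"
      using direct_sum_permutation[of \<sigma> k \<tau> "n - k"] by (auto simp: T_def)
  next
    fix p assume p: "p \<in> {p \<in> permutations_of_set {1..n}. Q p}"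
    then obtain k \<sigma> \<tau> where "k \<in> {1..n}" "\<sigma> \<in> indecomposables k"
        "\<tau> \<in> permutations_of_set {1..n - k}" "p = direct_sum \<sigma> \<tau>"
      using permutation_decomposition[of p n] assms by blast
    with p show "p \<in> f ` D"
      by (intro image_eqI[of _ _ "(k, \<sigma>, \<tau>)"]) (auto simp: f_def D_def T_def)
  qed
  then have "(\<Sum>p\<in>{p \<in> permutations_of_set {1..n}. Q p}. g p) = (\<Sum>x\<in>D. g (f x))"
    using sum.reindex[OF inj, of g] by simp
  also have "\<dots> = (\<Sum>k=1..n. \<Sum>\<sigma>\<in>indecomposables k. \<Sum>\<tau>\<in>T k \<sigma>. g (direct_sum \<sigma> \<tau>))"
    unfolding D_def by (simp add: sum.Sigma fin f_def split_def)
  finally show ?thesis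
    unfolding T_def .
qed

lemma indecomposables_1: "indecomposables 1 = {[1]}"
proof -
  have "first_component [1] = 1"
    unfolding first_component_def by (rule Least_equality) auto
  then show ?thesis
    by (auto simp: indecomposable_def)
qed

text \<open>The witnesses are the first letter and the letter 1. If the first letter were 1, the
  first component would have length 1.\<close>

lemma indecomposable_contains_21:
  assumes "\<sigma> \<in> indecomposables k" "2 \<le> k"
  obtains a b where "subseq [a, b] \<sigma>" "b < a"
proof -
  have len: "length \<sigma> = k" and set: "set \<sigma> = {1..k}" and first: "first_component \<sigma> = k"
    using assms(1) length_permutation by (auto simp: indecomposable_def dest: permutations_of_setD)
  obtain a xs where \<sigma>: "\<sigma> = a # xs"
    using len assms(2) by (cases \<sigma>) auto
  have "a \<noteq> 1"
  proof
    assume "a = 1"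
    then have "first_component \<sigma> \<le> 1"
      unfolding first_component_def \<sigma> by (intro Least_le) auto
    with first assms(2) show False by simp
  qed
  moreover have "1 \<in> set \<sigma>"
    using assms(2) by (simp add: set)
  moreover have "a \<in> {1..k}"
    unfolding set[symmetric] \<sigma> by simp
  ultimately have "subseq [a, 1] \<sigma>" "1 < a"
    using \<sigma> by (auto simp: subseq_singleton_left)
  then show thesis by (rule that)
qed

lemma avoids_Nil: "\<tau> \<noteq> [] \<Longrightarrow> avoids [] \<tau>"
  by (auto simp: avoids_def order_isomorphic_def)

lemma direct_sum_1: "direct_sum [1] \<tau> = 1 # map Suc \<tau>"
  by (simp add: direct_sum_def)

text \<open>A leading 1 could only be the first letter of an occurrence, where the pattern demands a
  smaller letter after it. The same reason serves for 213 below.\<close>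

lemma avoids_2134_direct_sum_1:
  "avoids (direct_sum [1] \<tau>) [2, 1, 3, 4] \<longleftrightarrow> avoids \<tau> [2, 1, 3, 4]"
proof -
  let ?p = "1 # map Suc \<tau>"
  have "avoids ?p [2, 1, 3, 4] \<longleftrightarrow> avoids (map Suc \<tau>) [2, 1, 3, 4]"
  proof
    assume R: "avoids (map Suc \<tau>) [2, 1, 3, 4]"
    show "avoids ?p [2, 1, 3, 4]"
      unfolding avoids_2134_iff
    proof (intro allI impI notI; elim conjE)
      fix a b c d assume *: "subseq [a, b, c, d] ?p" "b < a" "a < c" "c < d"
      \<comment> \<open>The letter \<open>b\<close> occurs in \<open>?p\<close>, so it is at least
        1, and \<open>a\<close> exceeds it.\<close>
      then have "a \<noteq> 1"
        using list_emb_set[OF *(1), of b] by auto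
      then show False
        using R *(2-) subseq_Cons2_neq[OF *(1)] unfolding avoids_2134_iff by fast
    qed
  next
    assume "avoids ?p [2, 1, 3, 4]"
    then show "avoids (map Suc \<tau>) [2, 1, 3, 4]"
      by (rule avoids_subseq) (rule list_emb_Cons, rule subseq_order.refl)
  qed
  then show ?thesis
    by (simp only: direct_sum_1 avoids_map strict_mono_Suc)
qed

lemma avoids_213_direct_sum_1:
  "avoids (direct_sum [1] \<tau>) [2, 1, 3] \<longleftrightarrow> avoids \<tau> [2, 1, 3]"
proof -
  let ?p = "1 # map Suc \<tau>"
  have "avoids ?p [2, 1, 3] \<longleftrightarrow> avoids (map Suc \<tau>) [2, 1, 3]"
  proof
    assume R: "avoids (map Suc \<tau>) [2, 1, 3]"
    show "avoids ?p [2, 1, 3]"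
      unfolding avoids_213_iff
    proof (intro allI impI notI; elim conjE)
      fix a b c assume *: "subseq [a, b, c] ?p" "b < a" "a < c"
      then have "a \<noteq> 1"
        using list_emb_set[OF *(1), of b] by auto
      then show False
        using R *(2-) subseq_Cons2_neq[OF *(1)] unfolding avoids_213_iff by fast
    qed
  next
    assume "avoids ?p [2, 1, 3]"
    then show "avoids (map Suc \<tau>) [2, 1, 3]"
      by (rule avoids_subseq) (rule list_emb_Cons, rule subseq_order.refl)
  qed
  then show ?thesis
    by (simp only: direct_sum_1 avoids_map strict_mono_Suc)
qed

text \<open>A descending pair of \<open>\<sigma>\<close> followed by any letter of the shifted
  \<open>\<tau>\<close> is an occurrence of 213.\<close>

lemma not_avoids_213_direct_sum:
  assumes "\<sigma> \<in> indecomposables k" "2 \<le> k" "\<tau> \<in> permutations_of_set {1..m}" "1 \<le> m"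
  shows "\<not> avoids (direct_sum \<sigma> \<tau>) [2, 1, 3]"
proof -
  obtain a b where ab: "subseq [a, b] \<sigma>" "b < a"
    using indecomposable_contains_21 assms(1,2) by blast
  let ?\<tau> = "map ((+) (length \<sigma>)) \<tau>"
  obtain c where c: "c \<in> set ?\<tau>"
    using assms(3,4) by (cases \<tau>) (auto simp: permutations_of_set_def)
  have "a < c"
    using direct_sum_less[of \<sigma> k \<tau> m a c] assms c ab list_emb_set[OF ab(1)] by auto
  moreover have "subseq ([a, b] @ [c]) (\<sigma> @ ?\<tau>)"
    using ab(1) c by (intro list_emb_append_mono) (auto simp only: subseq_singleton_left)
  ultimately show ?thesis
    using ab(2) unfolding avoids_213_iff direct_sum_def by force
qed

text \<open>A 213 in \<open>\<sigma>\<close> extends by any letter of \<open>\<tau>\<close>, and a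
  12 in \<open>\<tau>\<close> extends by a descending pair of \<open>\<sigma>\<close>. Conversely,
  an occurrence cut between the blocks leaves its first three letters in \<open>\<sigma>\<close> or
  its last two in \<open>\<tau>\<close>.\<close>

lemma avoids_2134_direct_sum_iff:
  assumes "\<sigma> \<in> indecomposables k" "2 \<le> k" "\<tau> \<in> permutations_of_set {1..m}" "1 \<le> m"
  shows "avoids (direct_sum \<sigma> \<tau>) [2, 1, 3, 4] \<longleftrightarrow> avoids \<sigma> [2, 1, 3] \<and> avoids \<tau> [1, 2]"
proof -
  define \<tau>' where "\<tau>' = map ((+) (length \<sigma>)) \<tau>"
  obtain a b where ab: "subseq [a, b] \<sigma>" "b < a"
    using indecomposable_contains_21 assms(1,2) by blast
  obtain e where e: "e \<in> set \<tau>'"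
    using assms(3,4) by (cases \<tau>) (auto simp: permutations_of_set_def \<tau>'_def)
  have less: "x < y" if "x \<in> set \<sigma>" "y \<in> set \<tau>'" for x y
    using direct_sum_less[of \<sigma> k \<tau> m x y] assms that by (auto simp: \<tau>'_def)
  have "avoids (\<sigma> @ \<tau>') [2, 1, 3, 4] \<longleftrightarrow> avoids \<sigma> [2, 1, 3] \<and> avoids \<tau>' [1, 2]"
  proof (intro iffI conjI)
    assume L: "avoids (\<sigma> @ \<tau>') [2, 1, 3, 4]"
    show "avoids \<sigma> [2, 1, 3]"
      unfolding avoids_213_iff
    proof (intro allI impI)
      fix x y z assume xyz: "subseq [x, y, z] \<sigma>"
      then have "subseq ([x, y, z] @ [e]) (\<sigma> @ \<tau>')"
        using e by (intro list_emb_append_mono) (auto simp only: subseq_singleton_left)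
      moreover have "z < e"
        using less[of z e] list_emb_set[OF xyz] e by auto
      ultimately show "\<not> (y < x \<and> x < z)"
        using L unfolding avoids_2134_iff by force
    qed
    show "avoids \<tau>' [1, 2]"
      unfolding avoids_12_iff
    proof (intro allI impI)
      fix c d assume cd: "subseq [c, d] \<tau>'"
      then have "subseq ([a, b] @ [c, d]) (\<sigma> @ \<tau>')"
        using ab by (intro list_emb_append_mono)
      moreover have "a < c"
        using less[of a c] list_emb_set[OF ab(1)] list_emb_set[OF cd] by auto
      ultimately show "\<not> c < d"
        using L ab(2) unfolding avoids_2134_iff by force
    qed
  next
    assume R: "avoids \<sigma> [2, 1, 3] \<and> avoids \<tau>' [1, 2]"
    show "avoids (\<sigma> @ \<tau>') [2, 1, 3, 4]"
      unfolding avoids_2134_iff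
    proof (intro allI impI notI)
      fix x y z w assume xyzw: "subseq [x, y, z, w] (\<sigma> @ \<tau>')" "y < x \<and> x < z \<and> z < w"
      obtain xs1 xs2 where "[x, y, z, w] = xs1 @ xs2" "subseq xs1 \<sigma>" "subseq xs2 \<tau>'"
        using xyzw(1) by (rule subseq_appendE)
      moreover have "subseq [x, y, z, w] L \<Longrightarrow> subseq [x, y, z] L" for L
        by (rule subseq_order.trans[rotated], assumption) simp
      ultimately have "subseq [x, y, z] \<sigma> \<or> subseq [z, w] \<tau>'"
        by (auto simp: Cons_eq_append_conv dest: subseq_Cons')
      with R xyzw(2) show False
        unfolding avoids_213_iff avoids_12_iff by blast
    qed
  qed
  then show ?thesis
    by (simp only: direct_sum_def \<tau>'_def avoids_map strict_mono_plus_left)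
qed

section \<open>Decomposing weighted sums over avoiders\<close>

abbreviation avoiders :: "nat list \<Rightarrow> nat \<Rightarrow> nat list set" where
  "avoiders \<sigma> n \<equiv> {p \<in> permutations_of_set {1..n}. avoids p \<sigma>}"

abbreviation indecomposable_avoiders :: "nat list \<Rightarrow> nat \<Rightarrow> nat list set" where
  "indecomposable_avoiders \<sigma> n \<equiv> {p \<in> permutations_of_set {1..n}. avoids p \<sigma> \<and> indecomposable p}"

text \<open>The terms \<open>k = n\<close> (whole permutation indecomposable, \<open>\<tau>\<close>
  empty) and \<open>k = 1\<close> (\<open>\<sigma>\<close> equal to \<open>[1]\<close>) are
  isolated; they differ because \<open>n\<close> is at least 2. In the remaining terms
  \<open>\<sigma>\<close> has length at least 2 and \<open>\<tau>\<close> is nonempty.\<close>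

lemma sum_permutations_first_component':
  assumes "2 \<le> n"
  shows "(\<Sum>p\<in>{p \<in> permutations_of_set {1..n}. Q p}. g p) =
    (\<Sum>p\<in>{p \<in> permutations_of_set {1..n}. Q p \<and> indecomposable p}. g p) +
    (\<Sum>\<tau>\<in>{\<tau> \<in> permutations_of_set {1..n - 1}. Q (direct_sum [1] \<tau>)}. g (direct_sum [1] \<tau>)) +
    (\<Sum>k=2..n-1. \<Sum>\<sigma>\<in>indecomposables k.
       \<Sum>\<tau>\<in>{\<tau> \<in> permutations_of_set {1..n - k}. Q (direct_sum \<sigma> \<tau>)}. g (direct_sum \<sigma> \<tau>))"
proof -
  define F where "F k = (\<Sum>\<sigma>\<in>indecomposables k.
    \<Sum>\<tau>\<in>{\<tau> \<in> permutations_of_set {1..n - k}. Q (direct_sum \<sigma> \<tau>)}. g (direct_sum \<sigma> \<tau>))" for k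
  have "{1..n} = insert n (insert 1 {2..n-1})"
    using assms by auto
  then have "(\<Sum>k=1..n. F k) = F n + F 1 + (\<Sum>k=2..n-1. F k)"
    using assms by (simp add: add.assoc)
  moreover have "F 1 = (\<Sum>\<tau>\<in>{\<tau> \<in> permutations_of_set {1..n - 1}. Q (direct_sum [1] \<tau>)}. g (direct_sum [1] \<tau>))"
    unfolding F_def indecomposables_1 by simp
  moreover have "F n = (\<Sum>p\<in>{p \<in> permutations_of_set {1..n}. Q p \<and> indecomposable p}. g p)"
  proof -
    have "(\<Sum>\<tau>\<in>{\<tau> \<in> permutations_of_set {1..n - n}. Q (direct_sum \<sigma> \<tau>)}. g (direct_sum \<sigma> \<tau>)) =
        (if Q \<sigma> then g \<sigma> else 0)" for \<sigma>
    proof -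
      have "{\<tau> \<in> permutations_of_set {1..n - n}. Q (direct_sum \<sigma> \<tau>)} = (if Q \<sigma> then {[]} else {})"
        by auto
      then show ?thesis by simp
    qed
    then have "F n = (\<Sum>\<sigma>\<in>indecomposables n. if Q \<sigma> then g \<sigma> else 0)"
      unfolding F_def by simp
    also have "\<dots> = (\<Sum>\<sigma>\<in>{\<sigma> \<in> indecomposables n. Q \<sigma>}. g \<sigma>)"
      by (rule sum.inter_filter[symmetric]) simp
    also have "{\<sigma> \<in> indecomposables n. Q \<sigma>} = {p \<in> permutations_of_set {1..n}. Q p \<and> indecomposable p}"
      by auto
    finally show ?thesis .
  qed
  ultimately show ?thesis
    using sum_permutations_first_component[of n g Q] assms unfolding F_def by simp
qed

lemma avoiders_1: "2 \<le> length \<sigma> \<Longrightarrow> avoiders \<sigma> 1 = {[1]}"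
proof -
  assume "2 \<le> length \<sigma>"
  then have "avoids [1] \<sigma>"
    unfolding avoids_def by (auto dest!: order_isomorphic_length list_emb_length)
  then show ?thesis by auto
qed

lemma indecomposable_avoiders_1: "2 \<le> length \<sigma> \<Longrightarrow> indecomposable_avoiders \<sigma> 1 = {[1]}"
  using avoiders_1[of \<sigma>] indecomposables_1 by blast

text \<open>All terms with \<open>k\<close> from 2 to \<open>n - 1\<close> vanish by
  \<open>not_avoids_213_direct_sum\<close>.\<close>

lemma sum_avoiders_213:
  assumes "2 \<le> n"
  shows "(\<Sum>p\<in>avoiders [2, 1, 3] n. g p) =
    (\<Sum>p\<in>indecomposable_avoiders [2, 1, 3] n. g p) +
    (\<Sum>\<tau>\<in>avoiders [2, 1, 3] (n - 1). g (direct_sum [1] \<tau>))"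
proof -
  have "{\<tau> \<in> permutations_of_set {1..n - 1}. avoids (direct_sum [1] \<tau>) [2, 1, 3]} = avoiders [2, 1, 3] (n - 1)"
    unfolding avoids_213_direct_sum_1 ..
  moreover have "(\<Sum>\<sigma>\<in>indecomposables k. \<Sum>\<tau>\<in>{\<tau> \<in> permutations_of_set {1..n - k}.
      avoids (direct_sum \<sigma> \<tau>) [2, 1, 3]}. g (direct_sum \<sigma> \<tau>)) = 0" if "k \<in> {2..n-1}" for k
  proof (intro sum.neutral ballI)
    fix \<sigma> \<tau> assume "\<sigma> \<in> indecomposables k"
      "\<tau> \<in> {\<tau> \<in> permutations_of_set {1..n - k}. avoids (direct_sum \<sigma> \<tau>) [2, 1, 3]}"
    moreover have "2 \<le> k" "1 \<le> n - k"
      using that assms by auto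
    ultimately show "g (direct_sum \<sigma> \<tau>) = 0"
      using not_avoids_213_direct_sum[of \<sigma> k \<tau> "n - k"] by blast
  qed
  ultimately show ?thesis
    by (subst sum_permutations_first_component'[OF assms]) simp
qed

text \<open>For \<open>k\<close> from 2 to \<open>n - 1\<close> the block \<open>\<tau>\<close> must
  be the decreasing permutation, so each inner sum collapses to at most one term.\<close>

lemma sum_avoiders_2134:
  assumes "2 \<le> n"
  shows "(\<Sum>p\<in>avoiders [2, 1, 3, 4] n. g p) =
    (\<Sum>p\<in>indecomposable_avoiders [2, 1, 3, 4] n. g p) +
    (\<Sum>\<tau>\<in>avoiders [2, 1, 3, 4] (n - 1). g (direct_sum [1] \<tau>)) +
    (\<Sum>k=2..n-1. \<Sum>\<sigma>\<in>indecomposable_avoiders [2, 1, 3] k. g (direct_sum \<sigma> (rev [1..<Suc (n - k)])))"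
proof -
  have "{\<tau> \<in> permutations_of_set {1..n - 1}. avoids (direct_sum [1] \<tau>) [2, 1, 3, 4]} =
      avoiders [2, 1, 3, 4] (n - 1)"
    unfolding avoids_2134_direct_sum_1 ..
  moreover have "(\<Sum>\<sigma>\<in>indecomposables k. \<Sum>\<tau>\<in>{\<tau> \<in> permutations_of_set {1..n - k}.
      avoids (direct_sum \<sigma> \<tau>) [2, 1, 3, 4]}. g (direct_sum \<sigma> \<tau>)) =
      (\<Sum>\<sigma>\<in>indecomposable_avoiders [2, 1, 3] k. g (direct_sum \<sigma> (rev [1..<Suc (n - k)])))"
    if k: "k \<in> {2..n-1}" for k
  proof -
    let ?m = "n - k"
    have dec: "rev [1..<Suc ?m] \<in> permutations_of_set {1..?m}"
      by (intro permutations_of_setI) (auto simp del: upt_Suc)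
    have "(\<Sum>\<tau>\<in>{\<tau> \<in> permutations_of_set {1..?m}. avoids (direct_sum \<sigma> \<tau>) [2, 1, 3, 4]}. g (direct_sum \<sigma> \<tau>)) =
        (if avoids \<sigma> [2, 1, 3] then g (direct_sum \<sigma> (rev [1..<Suc ?m])) else 0)"
      if \<sigma>: "\<sigma> \<in> indecomposables k" for \<sigma>
    proof -
      have "avoids (direct_sum \<sigma> \<tau>) [2, 1, 3, 4] \<longleftrightarrow> avoids \<sigma> [2, 1, 3] \<and> \<tau> = rev [1..<Suc ?m]"
        if "\<tau> \<in> permutations_of_set {1..?m}" for \<tau>
        using avoids_2134_direct_sum_iff[OF \<sigma> _ that] avoids_12_permutation_iff[OF that] k by auto
      then have "{\<tau> \<in> permutations_of_set {1..?m}. avoids (direct_sum \<sigma> \<tau>) [2, 1, 3, 4]} =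
          (if avoids \<sigma> [2, 1, 3] then {rev [1..<Suc ?m]} else {})"
        using dec by auto
      then show ?thesis by simp
    qed
    then have "(\<Sum>\<sigma>\<in>indecomposables k. \<Sum>\<tau>\<in>{\<tau> \<in> permutations_of_set {1..?m}.
        avoids (direct_sum \<sigma> \<tau>) [2, 1, 3, 4]}. g (direct_sum \<sigma> \<tau>)) =
        (\<Sum>\<sigma>\<in>indecomposables k. if avoids \<sigma> [2, 1, 3] then g (direct_sum \<sigma> (rev [1..<Suc ?m])) else 0)"
      by simp
    also have "\<dots> = (\<Sum>\<sigma>\<in>{\<sigma> \<in> indecomposables k. avoids \<sigma> [2, 1, 3]}. g (direct_sum \<sigma> (rev [1..<Suc ?m])))"
      by (rule sum.inter_filter[symmetric]) simp
    also have "{\<sigma> \<in> indecomposables k. avoids \<sigma> [2, 1, 3]} = indecomposable_avoiders [2, 1, 3] k"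
      by auto
    finally show ?thesis .
  qed
  ultimately show ?thesis
    by (subst sum_permutations_first_component'[OF assms]) simp
qed

section \<open>Wilf equivalence of 1234 and 2134\<close>

definition insert_at :: "nat \<Rightarrow> nat \<Rightarrow> nat list \<Rightarrow> nat list" where
  "insert_at N j p = take j p @ N # drop j p"

text \<open>Deleting the letter \<open>Suc n\<close> and recording its position inverts the
  insertion. This is the parent-child relation of the generating trees.\<close>

lemma sum_permutations_insert_at:
  "(\<Sum>q\<in>{q \<in> permutations_of_set {1..Suc n}. Q q}. g q) =
   (\<Sum>p\<in>permutations_of_set {1..n}. \<Sum>j\<in>{j. j \<le> n \<and> Q (insert_at (Suc n) j p)}. g (insert_at (Suc n) j p))"
proof -
  let ?N = "Suc n"
  define D where "D = (SIGMA p:permutations_of_set {1..n}. {j. j \<le> n \<and> Q (insert_at ?N j p)})"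
  define f where "f = (\<lambda>(p, j). insert_at ?N j p)"
  have len: "length p = n" and notin: "?N \<notin> set p" if "p \<in> permutations_of_set {1..n}" for p
    using that by (simp_all add: length_finite_permutations_of_set permutations_of_set_def)
  have "inj_on f D"
  proof (rule inj_onI, clarify)
    fix p j p' j'
    assume D: "(p, j) \<in> D" "(p', j') \<in> D" and eq: "f (p, j) = f (p', j')"
    have "?N \<notin> set p" "?N \<notin> set p'" "length p = n" "length p' = n" "j \<le> n" "j' \<le> n"
      using D len notin unfolding D_def by blast+
    moreover from this have "?N \<notin> set (take j p)" "?N \<notin> set (drop j p)"
      by (meson in_set_takeD in_set_dropD)+
    then have "take j p = take j' p' \<and> drop j p = drop j' p'"
      using eq append_Cons_eq_iff[of ?N "take j p" "drop j p" "take j' p'" "drop j' p'"]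
      unfolding f_def insert_at_def by simp
    ultimately show "p = p' \<and> j = j'"
      by (metis append_take_drop_id length_take min.absorb2)
  qed
  moreover have "f ` D = {q \<in> permutations_of_set {1..?N}. Q q}"
  proof (intro equalityI subsetI)
    fix q assume "q \<in> f ` D"
    then obtain p j where pj: "p \<in> permutations_of_set {1..n}" "Q q" "q = insert_at ?N j p"
      unfolding D_def f_def by auto
    have "distinct (take j p @ drop j p)" "?N \<notin> set (take j p @ drop j p)"
      unfolding append_take_drop_id using pj(1) notin by (simp_all add: permutations_of_set_def)
    moreover have "distinct (us @ ?N # vs)" if "distinct (us @ vs)" "?N \<notin> set (us @ vs)" for us vs
      using that by simp
    ultimately have "distinct q"
      unfolding pj(3) insert_at_def by blast
    moreover have "set q = insert ?N (set (take j p @ drop j p))"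
      unfolding pj(3) insert_at_def by (simp del: append_take_drop_id)
    then have "set q = insert ?N {1..n}"
      unfolding append_take_drop_id using pj(1) by (simp add: permutations_of_set_def)
    moreover have "insert ?N {1..n} = {1..?N}"
      by auto
    ultimately show "q \<in> {q \<in> permutations_of_set {1..?N}. Q q}"
      using pj(2) by (simp add: permutations_of_set_def)
  next
    fix q assume "q \<in> {q \<in> permutations_of_set {1..?N}. Q q}"
    then have q: "set q = {1..?N}" "distinct q" "Q q"
      by (auto simp: permutations_of_set_def)
    then obtain us vs where uv: "q = us @ ?N # vs"
      using split_list[of ?N q] by auto
    have "set (us @ vs) = {1..?N} - {?N}"
      using q(1,2) unfolding uv by auto
    then have "us @ vs \<in> permutations_of_set {1..n}"
      using q(2) unfolding uv by (auto simp: permutations_of_set_def)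
    moreover have "q = insert_at ?N (length us) (us @ vs)"
      unfolding uv insert_at_def by simp
    moreover have "length us \<le> n"
      using len[OF calculation(1)] by simp
    ultimately show "q \<in> f ` D"
      using q(3) unfolding D_def f_def by (intro image_eqI[of _ _ "(us @ vs, length us)"]) auto
  qed
  ultimately have "(\<Sum>q\<in>{q \<in> permutations_of_set {1..?N}. Q q}. g q) = (\<Sum>x\<in>D. g (f x))"
    using sum.reindex[of f D g] by simp
  then show ?thesis
    unfolding D_def f_def by (simp add: sum.Sigma split_def)
qed

text \<open>Separates the old occurrences from those that use the inserted letter.\<close>

lemma subseq_insert_iff:
  "subseq xs (us @ N # vs) \<longleftrightarrow>
     subseq xs (us @ vs) \<or> (\<exists>xs1 xs2. xs = xs1 @ N # xs2 \<and> subseq xs1 us \<and> subseq xs2 vs)"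
proof
  assume "subseq xs (us @ N # vs)"
  then obtain xs1 xs2 where xs: "xs = xs1 @ xs2" "subseq xs1 us" "subseq xs2 (N # vs)"
    by (rule subseq_appendE)
  show "subseq xs (us @ vs) \<or> (\<exists>xs1 xs2. xs = xs1 @ N # xs2 \<and> subseq xs1 us \<and> subseq xs2 vs)"
  proof (cases "subseq xs2 vs")
    case True
    with xs show ?thesis by (auto intro: list_emb_append_mono)
  next
    case False
    with xs(3) obtain ys where "xs2 = N # ys" "subseq ys vs"
      by (auto elim: list_emb.cases)
    with xs show ?thesis by blast
  qed
next
  assume "subseq xs (us @ vs) \<or> (\<exists>xs1 xs2. xs = xs1 @ N # xs2 \<and> subseq xs1 us \<and> subseq xs2 vs)"
  then show "subseq xs (us @ N # vs)"
    by (auto intro: list_emb_append_mono subseq_order.trans[of xs "us @ vs"])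
qed

context
  fixes us vs :: "nat list" and N :: nat
  assumes less: "\<And>x. x \<in> set (us @ vs) \<Longrightarrow> x < N"
begin

lemma subseq_less:
  "subseq xs us \<Longrightarrow> x \<in> set xs \<Longrightarrow> x < N" "subseq xs vs \<Longrightarrow> x \<in> set xs \<Longrightarrow> x < N"
  using less by (auto elim: list_emb_set)

text \<open>The new maximum can only play the largest letter of the pattern. In an increasing
  pattern that letter is the last, so a new occurrence is an occurrence of the next shorter
  increasing pattern in \<open>us\<close>. The lemmas for 123 and 1234 follow the same
  argument.\<close>

lemma avoids_12_insert_max:
  "avoids (us @ N # vs) [1, 2] \<longleftrightarrow> avoids (us @ vs) [1, 2] \<and> us = []"
proof -
  have *: "subseq [a, b] (us @ N # vs) \<and> a < b \<longleftrightarrow>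
      subseq [a, b] (us @ vs) \<and> a < b \<or> a \<in> set us \<and> b = N" (is "?L \<longleftrightarrow> ?R") for a b
  proof
    show "?L \<Longrightarrow> ?R"
      unfolding subseq_insert_iff
      using subseq_less(2)[of "[b]" b]
      by (auto simp: Cons_eq_append_conv subseq_singleton_left)
    have "subseq [a, b] (us @ N # vs)" if "a \<in> set us \<and> b = N"
      using that unfolding subseq_insert_iff
      by (intro disjI2 exI[of _ "[a]"] exI[of _ "[]"]) (simp add: subseq_singleton_left)
    then show "?R \<Longrightarrow> ?L"
      using subseq_less(1)[of "[a]" a] subseq_insert_iff[of "[a, b]" us N vs]
      by (auto simp: subseq_singleton_left)
  qed
  have "avoids (us @ N # vs) [1, 2] \<longleftrightarrow> \<not> (\<exists>a b. subseq [a, b] (us @ N # vs) \<and> a < b)"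
    unfolding avoids_12_iff by blast
  then show ?thesis
    unfolding * avoids_12_iff set_empty[symmetric, of us] ex_disj_distrib by (simp; blast)
qed

lemma avoids_123_insert_max:
  "avoids (us @ N # vs) [1, 2, 3] \<longleftrightarrow> avoids (us @ vs) [1, 2, 3] \<and> avoids us [1, 2]"
proof -
  have *: "subseq [a, b, c] (us @ N # vs) \<and> a < b \<and> b < c \<longleftrightarrow>
      subseq [a, b, c] (us @ vs) \<and> a < b \<and> b < c \<or> subseq [a, b] us \<and> a < b \<and> c = N" (is "?L \<longleftrightarrow> ?R") for a b c
  proof
    show "?L \<Longrightarrow> ?R"
      unfolding subseq_insert_iff
      using subseq_less(2)[of "[b, c]" b] subseq_less(2)[of "[c]" c]
      by (auto simp: Cons_eq_append_conv subseq_singleton_left)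
    have "subseq [a, b, c] (us @ N # vs)" if "subseq [a, b] us \<and> a < b \<and> c = N"
      using that unfolding subseq_insert_iff
      by (intro disjI2 exI[of _ "[a, b]"] exI[of _ "[]"]) (simp add: subseq_singleton_left)
    then show "?R \<Longrightarrow> ?L"
      using subseq_less(1)[of "[a, b]" b] subseq_insert_iff[of "[a, b, c]" us N vs]
      by (auto simp: subseq_singleton_left)
  qed
  have "avoids (us @ N # vs) [1, 2, 3] \<longleftrightarrow> \<not> (\<exists>a b c. subseq [a, b, c] (us @ N # vs) \<and> a < b \<and> b < c)"
    unfolding avoids_123_iff by blast
  then show ?thesis
    unfolding * avoids_123_iff avoids_12_iff ex_disj_distrib by (simp; blast)
qed

lemma avoids_1234_insert_max:
  "avoids (us @ N # vs) [1, 2, 3, 4] \<longleftrightarrow> avoids (us @ vs) [1, 2, 3, 4] \<and> avoids us [1, 2, 3]"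
proof -
  have *: "subseq [a, b, c, d] (us @ N # vs) \<and> a < b \<and> b < c \<and> c < d \<longleftrightarrow>
      subseq [a, b, c, d] (us @ vs) \<and> a < b \<and> b < c \<and> c < d \<or> subseq [a, b, c] us \<and> a < b \<and> b < c \<and> d = N" (is "?L \<longleftrightarrow> ?R") for a b c d
  proof
    show "?L \<Longrightarrow> ?R"
      unfolding subseq_insert_iff
      using subseq_less(2)[of "[b, c, d]" b] subseq_less(2)[of "[c, d]" c] subseq_less(2)[of "[d]" d]
      by (auto simp: Cons_eq_append_conv subseq_singleton_left)
    have "subseq [a, b, c, d] (us @ N # vs)" if "subseq [a, b, c] us \<and> a < b \<and> b < c \<and> d = N"
      using that unfolding subseq_insert_iff
      by (intro disjI2 exI[of _ "[a, b, c]"] exI[of _ "[]"]) (simp add: subseq_singleton_left)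
    then show "?R \<Longrightarrow> ?L"
      using subseq_less(1)[of "[a, b, c]" c] subseq_insert_iff[of "[a, b, c, d]" us N vs]
      by (auto simp: subseq_singleton_left)
  qed
  have "avoids (us @ N # vs) [1, 2, 3, 4] \<longleftrightarrow> \<not> (\<exists>a b c d. subseq [a, b, c, d] (us @ N # vs) \<and> a < b \<and> b < c \<and> c < d)"
    unfolding avoids_1234_iff by blast
  then show ?thesis
    unfolding * avoids_1234_iff avoids_123_iff ex_disj_distrib by (simp; blast)
qed

text \<open>Here the largest letter of the pattern stands third, so a new occurrence consists of an
  ascending pair before \<open>N\<close> and a still larger letter after \<open>N\<close>.\<close>

lemma avoids_1243_insert_max:
  "avoids (us @ N # vs) [1, 2, 4, 3] \<longleftrightarrow> avoids (us @ vs) [1, 2, 4, 3] \<and> 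
     \<not> (\<exists>a b c. subseq [a, b] us \<and> c \<in> set vs \<and> a < b \<and> b < c)"
proof -
  have *: "subseq [a, b, c, d] (us @ N # vs) \<and> a < b \<and> b < d \<and> d < c \<longleftrightarrow>
      subseq [a, b, c, d] (us @ vs) \<and> a < b \<and> b < d \<and> d < c \<or> subseq [a, b] us \<and> d \<in> set vs \<and> a < b \<and> b < d \<and> c = N" (is "?L \<longleftrightarrow> ?R") for a b c d
  proof
    show "?L \<Longrightarrow> ?R"
      unfolding subseq_insert_iff
      using subseq_less(2)[of "[b, c, d]" b] subseq_less(2)[of "[c, d]" d] subseq_less(2)[of "[d]" d] subseq_less(1)[of "[a, b, c]" c]
      by (auto simp: Cons_eq_append_conv subseq_singleton_left)
    have "subseq [a, b, c, d] (us @ N # vs)" if "subseq [a, b] us \<and> d \<in> set vs \<and> a < b \<and> b < d \<and> c = N"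
      using that unfolding subseq_insert_iff
      by (intro disjI2 exI[of _ "[a, b]"] exI[of _ "[d]"]) (simp add: subseq_singleton_left)
    then show "?R \<Longrightarrow> ?L"
      using subseq_less(2)[of "[d]" d] subseq_insert_iff[of "[a, b, c, d]" us N vs]
      by (auto simp: subseq_singleton_left)
  qed
  have "avoids (us @ N # vs) [1, 2, 4, 3] \<longleftrightarrow> \<not> (\<exists>a b c d. subseq [a, b, c, d] (us @ N # vs) \<and> a < b \<and> b < d \<and> d < c)"
    unfolding avoids_1243_iff by blast
  then show ?thesis
    unfolding * avoids_1243_iff ex_disj_distrib by (simp; blast)
qed

end

section \<open>Insertion sites and their change under insertion\<close>

definition down_sites :: "nat list \<Rightarrow> nat list \<Rightarrow> nat set" where
  "down_sites \<tau> p = {j. j \<le> length p \<and> avoids (take j p) \<tau>}"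

text \<open>The admissible sites of a 1243-avoider, the counterpart of
  \<open>down_sites [1, 2, 3]\<close> for 1234-avoiders; in both trees
  \<open>down_sites [1, 2]\<close> is counted by the label x. These sites need not form an initial
  segment: for the permutation 123 they are 0, 1 and 3.\<close>

definition sites_1243 :: "nat list \<Rightarrow> nat set" where
  "sites_1243 p = {j. j \<le> length p \<and>
     \<not> (\<exists>a b c. subseq [a, b] (take j p) \<and> c \<in> set (drop j p) \<and> a < b \<and> b < c)}"

lemma finite_sites [simp]: "finite (down_sites \<tau> p)" "finite (sites_1243 p)"
  unfolding down_sites_def sites_1243_def by auto

text \<open>Makes a downward closed set of sites recoverable from its cardinality, so that labels
  alone carry the needed information.\<close>

lemma lower_set_eq_lessThan_card:
  fixes S :: "nat set"
  assumes "finite S" "\<And>i j. i \<in> S \<Longrightarrow> j \<le> i \<Longrightarrow> j \<in> S"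
  shows "S = {..<card S}"
proof (cases "S = {}")
  case False
  have "S = {..Max S}"
    using assms False by (auto intro: Max_in Max_ge)
  then show ?thesis
    by (metis card_atMost lessThan_Suc_atMost)
qed simp

lemma subseq_take_mono: "i \<le> j \<Longrightarrow> subseq (take i p) (take j p)"
  by (rule prefix_imp_subseq) (metis min.absorb1 take_is_prefix take_take)

lemma down_sites_eq: "down_sites \<tau> p = {..<card (down_sites \<tau> p)}"
proof (rule lower_set_eq_lessThan_card)
  fix i j assume "i \<in> down_sites \<tau> p" "j \<le> i"
  then show "j \<in> down_sites \<tau> p"
    using avoids_subseq[OF _ subseq_take_mono[of j i p]] by (simp add: down_sites_def)
qed simp

lemma zero_in_down_sites: "\<tau> \<noteq> [] \<Longrightarrow> 0 \<in> down_sites \<tau> p"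
  by (auto simp: down_sites_def avoids_def order_isomorphic_def)

lemma card_down_sites_pos: "\<tau> \<noteq> [] \<Longrightarrow> 0 < card (down_sites \<tau> p)"
  using zero_in_down_sites[of \<tau> p] by (auto simp: card_gt_0_iff)

text \<open>With no ascending pair before the site, a new maximum cannot complete a forbidden
  pattern. Hence the first x sites are admissible in both trees, and x is at most y.\<close>

lemma down_sites_12_subset:
  "down_sites [1, 2] p \<subseteq> down_sites [1, 2, 3] p" "down_sites [1, 2] p \<subseteq> sites_1243 p"
proof -
  show "down_sites [1, 2] p \<subseteq> down_sites [1, 2, 3] p"
    unfolding down_sites_def avoids_12_iff avoids_123_iff
    using subseq_order.trans[of "[_, _]" "[_, _, _]"] by (smt (verit) Collect_mono subseq_Cons' subseq_Cons2)
  show "down_sites [1, 2] p \<subseteq> sites_1243 p"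
    unfolding down_sites_def sites_1243_def avoids_12_iff by blast
qed

lemma take_insert_at_le: "j \<le> length p \<Longrightarrow> i \<le> j \<Longrightarrow> take i (insert_at N j p) = take i p"
  by (simp add: insert_at_def min_absorb1)

lemma drop_insert_at_le: "j \<le> length p \<Longrightarrow> i \<le> j \<Longrightarrow> set (drop i (insert_at N j p)) = insert N (set (drop i p))"
proof -
  assume j: "j \<le> length p" "i \<le> j"
  then have "drop i p = drop i (take j p) @ drop j p"
    by (metis append_take_drop_id drop_append length_take min.absorb2 diff_is_0_eq drop_0)
  with j show ?thesis
    by (auto simp: insert_at_def)
qed

lemma take_insert_at_Suc:
  "j \<le> i \<Longrightarrow> i \<le> length p \<Longrightarrow> take (Suc i) (insert_at N j p) = take j p @ N # take (i - j) (drop j p)"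
  by (simp add: insert_at_def min_absorb2 Suc_diff_le)

lemma drop_insert_at_Suc: "j \<le> i \<Longrightarrow> i \<le> length p \<Longrightarrow> drop (Suc i) (insert_at N j p) = drop i p"
  by (simp add: insert_at_def min_absorb2 Suc_diff_le)

lemma take_append_take_drop: "j \<le> i \<Longrightarrow> take j p @ take (i - j) (drop j p) = take i p"
  by (metis le_add_diff_inverse take_add)

lemma length_insert_at [simp]: "length (insert_at N j p) = Suc (length p)"
  by (simp add: insert_at_def)

text \<open>Insertion splits site \<open>j\<close> into the sites \<open>j\<close> and
  \<open>Suc j\<close>. Old sites up to \<open>j\<close> keep their index and old sites from
  \<open>j\<close> on move up by one, so \<open>j\<close> contributes to both sets.\<close>

lemma in_sites_insert_at_cases:
  assumes "j \<le> length p"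
  shows "{i. i \<le> length (insert_at N j p) \<and> P i} =
    {i. i \<le> j \<and> P i} \<union> Suc ` {i. j \<le> i \<and> i \<le> length p \<and> P (Suc i)}"
proof (intro set_eqI iffI)
  fix i assume i: "i \<in> {i. i \<le> length (insert_at N j p) \<and> P i}"
  show "i \<in> {i. i \<le> j \<and> P i} \<union> Suc ` {i. j \<le> i \<and> i \<le> length p \<and> P (Suc i)}"
  proof (cases "i \<le> j")
    case False
    then obtain i' where "i = Suc i'" by (cases i) auto
    with False i show ?thesis by auto
  qed (use i in auto)
qed (use assms in auto)

context
  fixes p :: "nat list" and N j :: nat
  assumes less: "\<And>x. x \<in> set p \<Longrightarrow> x < N" and j: "j \<le> length p"
begin

lemma less_split: "x \<in> set (take j p @ take m (drop j p)) \<Longrightarrow> x < N" "x \<in> set (take j p @ drop j p) \<Longrightarrow> x < N"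
  using less by (auto dest: in_set_takeD in_set_dropD)

lemma down_sites_insert_at:
  "down_sites \<tau> (insert_at N j p) = {i \<in> down_sites \<tau> p. i \<le> j} \<union>
     Suc ` {i. j \<le> i \<and> i \<le> length p \<and> avoids (take j p @ N # take (i - j) (drop j p)) \<tau>}"
  unfolding down_sites_def in_sites_insert_at_cases[OF j]
  using j take_insert_at_le[of j p _ N] take_insert_at_Suc[of j _ p N]
  by (intro arg_cong2[where f = "(\<union>)"] image_cong Collect_cong) auto

text \<open>At the front, \<open>N\<close> ends no ascending pair: all old sites survive and the
  front site is doubled. Elsewhere \<open>N\<close> forms an ascending pair with any earlier letter,
  which rules out every site to its right.\<close>

lemma card_down_sites_12_insert_at:
  assumes "x = card (down_sites [1, 2] p)"
  shows "card (down_sites [1, 2] (insert_at N j p)) = (if j = 0 then Suc x else min x (Suc j))"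
proof -
  have x: "down_sites [1, 2] p = {..<x}" "0 < x"
    using down_sites_eq[of "[1, 2]" p] card_down_sites_pos[of "[1, 2]" p] assms by auto
  have "down_sites [1, 2] (insert_at N j p) = {i. i < x \<and> i \<le> j} \<union> Suc ` {i. j = 0 \<and> i < x}"
  proof -
    have "j \<le> i \<and> i \<le> length p \<and> avoids (take j p @ N # take (i - j) (drop j p)) [1, 2] \<longleftrightarrow> j = 0 \<and> i < x" for i
    proof -
      have "take j p = [] \<longleftrightarrow> j = 0" using j by auto
      moreover have "i \<le> length p \<and> avoids (take i p) [1, 2] \<longleftrightarrow> i < x"
        using x(1) unfolding down_sites_def by blast
      moreover have "avoids (take j p @ N # take (i - j) (drop j p)) [1, 2] \<longleftrightarrow>
          avoids (take j p @ take (i - j) (drop j p)) [1, 2] \<and> take j p = []"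
        by (rule avoids_12_insert_max) (rule less_split)
      ultimately show ?thesis
        by (metis take_append_take_drop le0)
    qed
    then show ?thesis
      unfolding down_sites_insert_at x(1) by simp
  qed
  also have "\<dots> = {..<(if j = 0 then Suc x else min x (Suc j))}"
  proof (cases "j = 0")
    case True
    with x(2) show ?thesis by (auto simp: lessThan_Suc_eq_insert_0)
  qed auto
  finally show ?thesis by simp
qed

text \<open>For \<open>j < x\<close> no ascending pair precedes \<open>N\<close>, so
  \<open>N\<close> ends no 123: every site survives and site \<open>j\<close> is doubled. Otherwise
  \<open>N\<close> ends a 123, and only the sites 0 to \<open>j\<close> survive.\<close>

lemma card_down_sites_123_insert_at:
  assumes "x = card (down_sites [1, 2] p)" "y = card (down_sites [1, 2, 3] p)" "j < y"
  shows "card (down_sites [1, 2, 3] (insert_at N j p)) = (if j < x then Suc y else Suc j)"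
proof -
  have x: "down_sites [1, 2] p = {..<x}" and y: "down_sites [1, 2, 3] p = {..<y}"
    using down_sites_eq[of "[1, 2]" p] down_sites_eq[of "[1, 2, 3]" p] assms by auto
  have "down_sites [1, 2, 3] (insert_at N j p) = {i. i < y \<and> i \<le> j} \<union> Suc ` {i. j < x \<and> j \<le> i \<and> i < y}"
  proof -
    have "j \<le> i \<and> i \<le> length p \<and> avoids (take j p @ N # take (i - j) (drop j p)) [1, 2, 3] \<longleftrightarrow>
        j < x \<and> j \<le> i \<and> i < y" for i
    proof -
      have "avoids (take j p) [1, 2] \<longleftrightarrow> j < x"
        using x j unfolding down_sites_def by blast
      moreover have "i \<le> length p \<and> avoids (take i p) [1, 2, 3] \<longleftrightarrow> i < y"
        using y unfolding down_sites_def by blast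
      moreover have "avoids (take j p @ N # take (i - j) (drop j p)) [1, 2, 3] \<longleftrightarrow>
          avoids (take j p @ take (i - j) (drop j p)) [1, 2, 3] \<and> avoids (take j p) [1, 2]"
        by (rule avoids_123_insert_max) (rule less_split)
      ultimately show ?thesis
        by (metis take_append_take_drop)
    qed
    then show ?thesis
      unfolding down_sites_insert_at y by simp
  qed
  also have "\<dots> = {..<(if j < x then Suc y else Suc j)}"
  proof -
    have "i \<in> Suc ` {i. j \<le> i \<and> i < y} \<longleftrightarrow> Suc j \<le> i \<and> i < Suc y" for i
      by (cases i) auto
    then show ?thesis
      using assms(3) by auto
  qed
  finally show ?thesis by simp
qed

text \<open>A site left of \<open>N\<close> has a letter above everything after it, so it survives
  iff no ascending pair precedes it. At a site right of \<open>N\<close> the status is unchanged,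
  because \<open>N\<close> cannot lie below a later letter.\<close>

lemma card_sites_1243_insert_at:
  assumes "x = card (down_sites [1, 2] p)" "y = card (sites_1243 p)" "j \<in> sites_1243 p"
  shows "card (sites_1243 (insert_at N j p)) =
    (if j < x then Suc y else x + card {i \<in> sites_1243 p. j \<le> i})"
proof -
  have x: "down_sites [1, 2] p = {..<x}"
    using down_sites_eq[of "[1, 2]" p] assms by auto
  have "sites_1243 (insert_at N j p) = {i. i < x \<and> i \<le> j} \<union> Suc ` {i \<in> sites_1243 p. j \<le> i}"
    unfolding sites_1243_def in_sites_insert_at_cases[OF j]
  proof (intro arg_cong2[where f = "(\<union>)"] image_cong Collect_cong refl)
    fix i
    have "i \<le> length p \<and> avoids (take i p) [1, 2] \<longleftrightarrow> i < x"
      using x unfolding down_sites_def by blast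
    moreover have "b < N" if "subseq [a, b] (take i p)" for a b
      using list_emb_set[OF that, of b] less by (auto dest: in_set_takeD)
    moreover have "b < N" if "b \<in> set (drop i p)" for b
      using that less by (auto dest: in_set_dropD)
    ultimately show "(i \<le> j \<and> \<not> (\<exists>a b c. subseq [a, b] (take i (insert_at N j p)) \<and>
        c \<in> set (drop i (insert_at N j p)) \<and> a < b \<and> b < c)) = (i < x \<and> i \<le> j)"
      using j take_insert_at_le[OF j, of i N] drop_insert_at_le[OF j, of i N]
      unfolding avoids_12_iff by (smt (verit) insert_iff le_trans)
  next
    fix i
    show "(j \<le> i \<and> i \<le> length p \<and> \<not> (\<exists>a b c. subseq [a, b] (take (Suc i) (insert_at N j p)) \<and>
        c \<in> set (drop (Suc i) (insert_at N j p)) \<and> a < b \<and> b < c)) =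
      (i \<in> {j. j \<le> length p \<and> \<not> (\<exists>a b c. subseq [a, b] (take j p) \<and>
        c \<in> set (drop j p) \<and> a < b \<and> b < c)} \<and> j \<le> i)"
    proof (cases "j \<le> i \<and> i \<le> length p")
      case True
      have less_drop: "c < N" if "c \<in> set (drop i p)" for c
        using that less by (auto dest: in_set_dropD)
      have "subseq [a, b] (take (Suc i) (insert_at N j p)) \<longleftrightarrow> subseq [a, b] (take i p)"
        if "a < N" "b < N" for a b
        using True that subseq_insert_iff[of "[a, b]" "take j p" N "take (i - j) (drop j p)"]
        by (auto simp: take_insert_at_Suc take_append_take_drop Cons_eq_append_conv)
      then have "(\<exists>a b c. subseq [a, b] (take (Suc i) (insert_at N j p)) \<and> c \<in> set (drop i p) \<and> a < b \<and> b < c) =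
        (\<exists>a b c. subseq [a, b] (take i p) \<and> c \<in> set (drop i p) \<and> a < b \<and> b < c)"
        using less_drop by (meson less_trans)
      with True show ?thesis
        by (simp add: drop_insert_at_Suc)
    qed auto
  qed
  moreover have "{i. i < x \<and> i \<le> j} = {..<min x (Suc j)}"
    by auto
  moreover have "{..<min x (Suc j)} \<inter> Suc ` {i \<in> sites_1243 p. j \<le> i} = {}"
    by auto
  ultimately have card: "card (sites_1243 (insert_at N j p)) = min x (Suc j) + card {i \<in> sites_1243 p. j \<le> i}"
    by (simp add: card_Un_disjoint card_image)
  show ?thesis
  proof (cases "j < x")
    case True
    \<comment> \<open>All sites below \<open>j\<close> are admissible here, so the right part has
      \<open>y - j\<close> elements; with \<open>Suc j\<close> sites on the left the total is
      \<open>Suc y\<close>.\<close>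
    then have "sites_1243 p = {..<j} \<union> {i \<in> sites_1243 p. j \<le> i}"
      using x down_sites_12_subset(2)[of p] by auto
    then have "y = card ({..<j} \<union> {i \<in> sites_1243 p. j \<le> i})"
      using assms(2) by simp
    also have "\<dots> = j + card {i \<in> sites_1243 p. j \<le> i}"
      by (subst card_Un_disjoint) auto
    finally show ?thesis
      using card True by simp
  qed (simp add: card)
qed

end

text \<open>The total weight of the children of a node labelled (x, y). The summands belong to the
  front site, to the other sites below x, and to the remaining admissible sites.\<close>

definition label_step :: "(nat \<Rightarrow> nat \<Rightarrow> nat) \<Rightarrow> nat \<Rightarrow> nat \<Rightarrow> nat" where
  "label_step f x y = f (Suc x) (Suc y) + (\<Sum>j=1..<x. f (Suc j) (Suc y)) + (\<Sum>j=x..<y. f x (Suc j))"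

lemma sum_split_zero_below:
  fixes S :: "nat set"
  assumes "finite S" "0 < x" "{..<x} \<subseteq> S"
  shows "sum g S = g 0 + sum g {1..<x} + sum g {j \<in> S. x \<le> j}"
proof -
  have "S = insert 0 {1..<x} \<union> {j \<in> S. x \<le> j}"
    using assms by force
  moreover have "sum g (insert 0 {1..<x} \<union> {j \<in> S. x \<le> j}) =
      sum g (insert 0 {1..<x}) + sum g {j \<in> S. x \<le> j}"
    using assms by (intro sum.union_disjoint) auto
  ultimately show ?thesis
    by simp
qed

text \<open>The elements of \<open>S\<close> are ranked from the right: each rank from 1 to
  \<open>card S\<close> occurs once. A new minimum receives the top rank and leaves the other ranks
  unchanged.\<close>

lemma sum_card_upper_segments:
  fixes S :: "nat set"
  assumes "finite S"
  shows "(\<Sum>j\<in>S. h (card {i \<in> S. j \<le> i})) = (\<Sum>k=1..card S. h k)"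
  using assms
proof (induction S rule: finite_linorder_min_induct)
  case (insert b A)
  have "{i \<in> insert b A. b \<le> i} = insert b A"
    using insert.hyps by auto
  moreover have "{i \<in> insert b A. j \<le> i} = {i \<in> A. j \<le> i}" if "j \<in> A" for j
    using insert.hyps that by force
  moreover have "b \<notin> A"
    using insert.hyps by auto
  ultimately show ?case
    using insert by (simp add: add.commute)
qed simp

text \<open>The admissible sites are 0 to y - 1. The front gives (x + 1, y + 1), a site j with 0 < j
  < x gives (j + 1, y + 1), and a site from x on gives (x, j + 1).\<close>

lemma sum_insert_at_1234:
  assumes p: "p \<in> permutations_of_set {1..n}" "avoids p [1, 2, 3, 4]"
  shows "(\<Sum>j\<in>{j. j \<le> n \<and> avoids (insert_at (Suc n) j p) [1, 2, 3, 4]}.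
      f (card (down_sites [1, 2] (insert_at (Suc n) j p))) (card (down_sites [1, 2, 3] (insert_at (Suc n) j p)))) =
    label_step f (card (down_sites [1, 2] p)) (card (down_sites [1, 2, 3] p))"
proof -
  let ?x = "card (down_sites [1, 2] p)" and ?y = "card (down_sites [1, 2, 3] p)"
  have less: "x < Suc n" if "x \<in> set p" for x
    using p(1) that by (auto simp: permutations_of_set_def)
  have len: "length p = n"
    using p(1) by (simp add: length_finite_permutations_of_set)
  have "avoids (insert_at (Suc n) j p) [1, 2, 3, 4] \<longleftrightarrow> avoids (take j p) [1, 2, 3]" for j
    using avoids_1234_insert_max[of "take j p" "drop j p" "Suc n"] p(2) less
    unfolding insert_at_def append_take_drop_id by blast
  then have sites: "{j. j \<le> n \<and> avoids (insert_at (Suc n) j p) [1, 2, 3, 4]} = down_sites [1, 2, 3] p"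
    by (simp add: down_sites_def len)
  have y: "down_sites [1, 2, 3] p = {..<?y}" and x: "down_sites [1, 2] p = {..<?x}"
    by (rule down_sites_eq)+
  have sub: "{..<?x} \<subseteq> {..<?y}"
    using down_sites_12_subset(1)[of p] x y by simp
  have pos: "0 < ?x"
    by (simp add: card_down_sites_pos)
  define g where "g j = (if j = 0 then f (Suc ?x) (Suc ?y) else if j < ?x then f (Suc j) (Suc ?y) else f ?x (Suc j))" for j
  have "(\<Sum>j\<in>down_sites [1, 2, 3] p.
      f (card (down_sites [1, 2] (insert_at (Suc n) j p))) (card (down_sites [1, 2, 3] (insert_at (Suc n) j p)))) =
      (\<Sum>j\<in>down_sites [1, 2, 3] p. g j)"
  proof (rule sum.cong[OF refl])
    fix j assume "j \<in> down_sites [1, 2, 3] p"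
    then have j: "j \<le> length p" "j < ?y"
      using equalityD1[OF y] by (simp add: down_sites_def, blast)
    have "min ?x (Suc j) = (if j < ?x then Suc j else ?x)"
      by auto
    then show "f (card (down_sites [1, 2] (insert_at (Suc n) j p))) (card (down_sites [1, 2, 3] (insert_at (Suc n) j p))) = g j"
      using pos card_down_sites_12_insert_at[OF less j(1) refl]
        card_down_sites_123_insert_at[OF less j(1) refl refl j(2)]
      unfolding g_def by auto
  qed
  also have "\<dots> = (\<Sum>j<?y. g j)"
    using y by simp
  also have "\<dots> = g 0 + sum g {1..<?x} + sum g {j \<in> {..<?y}. ?x \<le> j}"
    by (rule sum_split_zero_below) (use pos sub in auto)
  also have "{j \<in> {..<?y}. ?x \<le> j} = {?x..<?y}"
    by auto
  also have "sum g {1..<?x} = (\<Sum>j=1..<?x. f (Suc j) (Suc ?y))"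
    by (rule sum.cong) (auto simp: g_def)
  also have "sum g {?x..<?y} = (\<Sum>j=?x..<?y. f ?x (Suc j))"
    using pos by (intro sum.cong) (auto simp: g_def)
  finally show ?thesis
    unfolding sites label_step_def g_def by simp
qed

text \<open>
  Inserting at an admissible site \<open>j \<ge> x\<close> kills exactly the sites in \<open>{x..<j}\<close> and the left half of the
  split site, so the \<open>k\<close>-th admissible site from the right produces the label \<open>(x, x + k)\<close>.
\<close>

lemma sum_insert_at_1243:
  assumes p: "p \<in> permutations_of_set {1..n}" "avoids p [1, 2, 4, 3]"
  shows "(\<Sum>j\<in>{j. j \<le> n \<and> avoids (insert_at (Suc n) j p) [1, 2, 4, 3]}.
      f (card (down_sites [1, 2] (insert_at (Suc n) j p))) (card (sites_1243 (insert_at (Suc n) j p)))) =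
    label_step f (card (down_sites [1, 2] p)) (card (sites_1243 p))"
proof -
  let ?x = "card (down_sites [1, 2] p)" and ?y = "card (sites_1243 p)"
  have less: "x < Suc n" if "x \<in> set p" for x
    using p(1) that by (auto simp: permutations_of_set_def)
  have len: "length p = n"
    using p(1) by (simp add: length_finite_permutations_of_set)
  have "avoids (insert_at (Suc n) j p) [1, 2, 4, 3] \<longleftrightarrow>
      \<not> (\<exists>a b c. subseq [a, b] (take j p) \<and> c \<in> set (drop j p) \<and> a < b \<and> b < c)" for j
    using avoids_1243_insert_max[of "take j p" "drop j p" "Suc n"] p(2) less
    unfolding insert_at_def append_take_drop_id by blast
  then have sites: "{j. j \<le> n \<and> avoids (insert_at (Suc n) j p) [1, 2, 4, 3]} = sites_1243 p"
    by (simp add: sites_1243_def len)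
  have x: "down_sites [1, 2] p = {..<?x}"
    by (rule down_sites_eq)
  then have sub: "{..<?x} \<subseteq> sites_1243 p"
    using down_sites_12_subset(2)[of p] by simp
  have pos: "0 < ?x"
    by (simp add: card_down_sites_pos)
  define S where "S = {j \<in> sites_1243 p. ?x \<le> j}"
  have "sites_1243 p = {..<?x} \<union> S"
    using sub unfolding S_def by auto
  then have "?y = card ({..<?x} \<union> S)"
    by simp
  also have "\<dots> = ?x + card S"
    unfolding S_def by (subst card_Un_disjoint) auto
  finally have y: "?y = ?x + card S" .
  \<comment> \<open>In the last case the label depends on the rank of \<open>j\<close> in
    \<open>S\<close> counted from the right, not on \<open>j\<close> itself.\<close>
  define g where "g j = (if j = 0 then f (Suc ?x) (Suc ?y) else if j < ?x then f (Suc j) (Suc ?y)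
    else f ?x (?x + card {i \<in> S. j \<le> i}))" for j
  have "(\<Sum>j\<in>sites_1243 p.
      f (card (down_sites [1, 2] (insert_at (Suc n) j p))) (card (sites_1243 (insert_at (Suc n) j p)))) =
      (\<Sum>j\<in>sites_1243 p. g j)"
  proof (rule sum.cong[OF refl])
    fix j assume j: "j \<in> sites_1243 p"
    then have len_j: "j \<le> length p"
      by (simp add: sites_1243_def)
    have "{i \<in> sites_1243 p. j \<le> i} = {i \<in> S. j \<le> i}" if "\<not> j < ?x"
      using that unfolding S_def by auto
    moreover have "min ?x (Suc j) = (if j < ?x then Suc j else ?x)"
      by auto
    ultimately show "f (card (down_sites [1, 2] (insert_at (Suc n) j p))) (card (sites_1243 (insert_at (Suc n) j p))) = g j"
      using pos card_down_sites_12_insert_at[OF less len_j refl]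
        card_sites_1243_insert_at[OF less len_j refl refl j]
      unfolding g_def by auto
  qed
  also have "\<dots> = g 0 + sum g {1..<?x} + sum g S"
    unfolding S_def by (rule sum_split_zero_below) (use pos sub in auto)
  also have "sum g {1..<?x} = (\<Sum>j=1..<?x. f (Suc j) (Suc ?y))"
    by (rule sum.cong) (auto simp: g_def)
  also have "sum g S = (\<Sum>j\<in>S. f ?x (?x + card {i \<in> S. j \<le> i}))"
    using pos by (intro sum.cong) (auto simp: g_def S_def)
  also have "\<dots> = (\<Sum>k=1..card S. f ?x (?x + k))"
    by (rule sum_card_upper_segments) (simp add: S_def)
  also have "\<dots> = (\<Sum>j=?x..<?y. f ?x (Suc j))"
    \<comment> \<open>Rank \<open>k\<close> corresponds to \<open>j = ?x + k - 1\<close>; the upper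
      ends match because \<open>?y = ?x + card S\<close>.\<close>
    by (rule sum.reindex_bij_witness[of _ "\<lambda>j. Suc j - ?x" "\<lambda>k. ?x + k - 1"]) (auto simp: y)
  finally show ?thesis
    unfolding sites label_step_def g_def by simp
qed

lemma avoids_insert_at_imp_avoids: "avoids (insert_at N j p) \<tau> \<Longrightarrow> avoids p \<tau>"
proof (rule avoids_subseq)
  have "subseq (take j p @ drop j p) (insert_at N j p)"
    unfolding insert_at_def by (intro list_emb_append_mono list_emb_Cons) auto
  then show "subseq p (insert_at N j p)"
    by simp
qed

text \<open>Deleting the maximum preserves avoidance, so only avoiders have avoiding children; the
  weight of one generation is thus a sum over the previous one.\<close>

lemma sum_avoiders_insert_at:
  assumes "\<And>p. p \<in> permutations_of_set {1..n} \<Longrightarrow> avoids p \<tau> \<Longrightarrow>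
    (\<Sum>j\<in>{j. j \<le> n \<and> avoids (insert_at (Suc n) j p) \<tau>}. g (insert_at (Suc n) j p)) = (h p :: nat)"
  shows "(\<Sum>q\<in>{q \<in> permutations_of_set {1..Suc n}. avoids q \<tau>}. g q) =
    (\<Sum>p\<in>{p \<in> permutations_of_set {1..n}. avoids p \<tau>}. h p)"
proof -
  have "(\<Sum>q\<in>{q \<in> permutations_of_set {1..Suc n}. avoids q \<tau>}. g q) =
      (\<Sum>p\<in>permutations_of_set {1..n}.
        \<Sum>j\<in>{j. j \<le> n \<and> avoids (insert_at (Suc n) j p) \<tau>}. g (insert_at (Suc n) j p))"
    by (rule sum_permutations_insert_at)
  also have "\<dots> = (\<Sum>p\<in>permutations_of_set {1..n}. if avoids p \<tau> then h p else 0)"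
  proof (intro sum.cong refl)
    fix p assume "p \<in> permutations_of_set {1..n}"
    moreover have "{j. j \<le> n \<and> avoids (insert_at (Suc n) j p) \<tau>} = {}" if "\<not> avoids p \<tau>"
      using that avoids_insert_at_imp_avoids by blast
    ultimately show "(\<Sum>j\<in>{j. j \<le> n \<and> avoids (insert_at (Suc n) j p) \<tau>}. g (insert_at (Suc n) j p)) =
        (if avoids p \<tau> then h p else 0)"
      using assms by (cases "avoids p \<tau>") (simp_all only: sum.empty if_True if_False simp_thms)
  qed
  also have "\<dots> = (\<Sum>p\<in>{p \<in> permutations_of_set {1..n}. avoids p \<tau>}. h p)"
    by (rule sum.inter_filter[symmetric]) simp
  finally show ?thesis .
qed

text \<open>
  Both trees have the same children rule, so the sums agree for every weight \<open>f\<close> on labels;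
  the induction replaces \<open>f\<close> by \<open>label_step f\<close>.
\<close>

lemma sum_labels_1234_eq_1243:
  fixes f :: "nat \<Rightarrow> nat \<Rightarrow> nat"
  shows "(\<Sum>p\<in>{p \<in> permutations_of_set {1..n}. avoids p [1, 2, 3, 4]}.
      f (card (down_sites [1, 2] p)) (card (down_sites [1, 2, 3] p))) =
   (\<Sum>p\<in>{p \<in> permutations_of_set {1..n}. avoids p [1, 2, 4, 3]}.
      f (card (down_sites [1, 2] p)) (card (sites_1243 p)))"
proof (induction n arbitrary: f)
  case 0
  \<comment> \<open>The empty permutation is the root of both trees, with label (1, 1).\<close>
  have "down_sites \<tau> [] = {0}" if "\<tau> \<noteq> []" for \<tau>
    using that zero_in_down_sites[of \<tau> "[]"] by (auto simp: down_sites_def)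
  moreover have "sites_1243 [] = {0}"
    by (auto simp: sites_1243_def)
  moreover have "{p \<in> permutations_of_set {1..0}. avoids p \<tau>} = {[]}" if "\<tau> \<noteq> []" for \<tau>
    using that by (auto simp: avoids_def order_isomorphic_def)
  ultimately show ?case
    by simp
next
  case (Suc n)
  have "(\<Sum>p\<in>{p \<in> permutations_of_set {1..Suc n}. avoids p [1, 2, 3, 4]}.
      f (card (down_sites [1, 2] p)) (card (down_sites [1, 2, 3] p))) =
    (\<Sum>p\<in>{p \<in> permutations_of_set {1..n}. avoids p [1, 2, 3, 4]}.
      label_step f (card (down_sites [1, 2] p)) (card (down_sites [1, 2, 3] p)))"
    by (rule sum_avoiders_insert_at, rule sum_insert_at_1234)
  also have "\<dots> = (\<Sum>p\<in>{p \<in> permutations_of_set {1..n}. avoids p [1, 2, 4, 3]}.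
      label_step f (card (down_sites [1, 2] p)) (card (sites_1243 p)))"
    by (rule Suc.IH)
  also have "\<dots> = (\<Sum>p\<in>{p \<in> permutations_of_set {1..Suc n}. avoids p [1, 2, 4, 3]}.
      f (card (down_sites [1, 2] p)) (card (sites_1243 p)))"
    by (rule sum_avoiders_insert_at[symmetric], rule sum_insert_at_1243)
  finally show ?case .
qed

lemma card_avoiders_1234_eq_1243:
  "card {p \<in> permutations_of_set {1..n}. avoids p [1, 2, 3, 4]} =
   card {p \<in> permutations_of_set {1..n}. avoids p [1, 2, 4, 3]}"
  unfolding card_eq_sum by (rule sum_labels_1234_eq_1243[of "\<lambda>_ _. 1" n])

section \<open>From 1243 to 2134 by reverse complement\<close>

lemma subseq_rev_iff: "subseq (rev xs) (rev ys) \<longleftrightarrow> subseq xs ys"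
proof -
  have "subseq (rev xs) (rev ys)" if "subseq xs ys" for xs ys :: "'a list"
    using that by induction (auto intro: list_emb_append_mono subseq_rev_drop_many)
  from this[of xs ys] this[of "rev xs" "rev ys"] show ?thesis by auto
qed

text \<open>Reversal takes 1243 to 3421, and complementation takes 3421 to 2134.\<close>

lemma avoids_2134_reverse_complement:
  assumes "p \<in> permutations_of_set {1..n}"
  shows "avoids (rev (map (\<lambda>x. Suc n - x) p)) [2, 1, 3, 4] \<longleftrightarrow> avoids p [1, 2, 4, 3]"
proof -
  let ?c = "\<lambda>x. Suc n - x"
  have set_p: "set p = {1..n}"
    using assms by (simp add: permutations_of_set_def)
  have rev: "subseq [d, c, b, a] (rev (map ?c p)) \<longleftrightarrow>
      (\<exists>a' b' c' d'. subseq [a', b', c', d'] p \<and> a = ?c a' \<and> b = ?c b' \<and> c = ?c c' \<and> d = ?c d')" for a b c d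
  proof -
    have "subseq [d, c, b, a] (rev (map ?c p)) \<longleftrightarrow> subseq [a, b, c, d] (map ?c p)"
      using subseq_rev_iff[of "[a, b, c, d]" "map ?c p"] by simp
    also have "\<dots> \<longleftrightarrow> (\<exists>zs. subseq zs p \<and> [a, b, c, d] = map ?c zs)"
      by (rule subseq_map_right_iff)
    also have "\<dots> \<longleftrightarrow> (\<exists>a' b' c' d'. subseq [a', b', c', d'] p \<and> a = ?c a' \<and> b = ?c b' \<and> c = ?c c' \<and> d = ?c d')"
      by (auto simp: Cons_eq_map_conv)
    finally show ?thesis .
  qed
  \<comment> \<open>Truncated subtraction reverses strict order only on values up to
    \<open>Suc n\<close>, so the letters are first placed in \<open>{1..n}\<close>.\<close>
  have order: "?c c < ?c d \<and> ?c d < ?c b \<and> ?c b < ?c a \<longleftrightarrow> a < b \<and> b < d \<and> d < c"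
    if "subseq [a, b, c, d] p" for a b c d
  proof -
    have "{a, b, c, d} \<subseteq> {1..n}"
      using list_emb_set[OF that] set_p by auto
    then show ?thesis by auto
  qed
  have "avoids (rev (map ?c p)) [2, 1, 3, 4] \<longleftrightarrow>
      \<not> (\<exists>a b c d. subseq [d, c, b, a] (rev (map ?c p)) \<and> c < d \<and> d < b \<and> b < a)"
    unfolding avoids_2134_iff by blast
  also have "\<dots> \<longleftrightarrow> \<not> (\<exists>a b c d. subseq [a, b, c, d] p \<and> ?c c < ?c d \<and> ?c d < ?c b \<and> ?c b < ?c a)"
    unfolding rev by blast
  also have "\<dots> \<longleftrightarrow> avoids p [1, 2, 4, 3]"
    using order unfolding avoids_1243_iff by blast
  finally show ?thesis .
qed

lemma card_avoiders_1243_eq_2134: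
  "card {p \<in> permutations_of_set {1..n}. avoids p [1, 2, 4, 3]} =
   card {p \<in> permutations_of_set {1..n}. avoids p [2, 1, 3, 4]}"
proof -
  let ?c = "\<lambda>x. Suc n - x" and ?P = "permutations_of_set {1..n}"
  let ?f = "\<lambda>p. rev (map ?c p)"
  have inv: "?f (?f p) = p" if "p \<in> ?P" for p
    using that by (auto simp: rev_map permutations_of_set_def intro!: map_idI)
  have closed: "?f p \<in> ?P" if "p \<in> ?P" for p
  proof -
    have "inj_on ?c {1..n}"
      by (auto simp: inj_on_def)
    moreover have "?c ` {1..n} = {1..n}"
    proof (intro equalityI subsetI)
      fix x assume "x \<in> {1..n}"
      then show "x \<in> ?c ` {1..n}"
        by (intro image_eqI[of _ _ "?c x"]) auto
    qed auto
    ultimately show ?thesis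
      using that by (simp add: permutations_of_set_def distinct_map)
  qed
  have "bij_betw ?f {p \<in> ?P. avoids p [1, 2, 4, 3]} {p \<in> ?P. avoids p [2, 1, 3, 4]}"
  proof (rule bij_betw_byWitness[of _ ?f])
    show "?f ` {p \<in> ?P. avoids p [1, 2, 4, 3]} \<subseteq> {p \<in> ?P. avoids p [2, 1, 3, 4]}"
      using closed avoids_2134_reverse_complement by blast
    show "?f ` {p \<in> ?P. avoids p [2, 1, 3, 4]} \<subseteq> {p \<in> ?P. avoids p [1, 2, 4, 3]}"
    proof
      fix q assume "q \<in> ?f ` {p \<in> ?P. avoids p [2, 1, 3, 4]}"
      then obtain p where p: "p \<in> ?P" "avoids p [2, 1, 3, 4]" "q = ?f p"
        by blast
      then show "q \<in> {p \<in> ?P. avoids p [1, 2, 4, 3]}"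
        using closed[of p] inv[of p] avoids_2134_reverse_complement[of "?f p" n] by simp
    qed
  qed (use inv in auto)
  then show ?thesis
    by (rule bij_betw_same_card)
qed

theorem card_avoiders_2134_eq_E_num:
  "card {p \<in> permutations_of_set {1..n}. avoids p [2, 1, 3, 4]} = E_num n"
  unfolding E_num_def by (simp only: card_avoiders_1234_eq_1243 card_avoiders_1243_eq_2134)

section \<open>Catalan numbers and 213-avoiders\<close>

lemma catalan_num_0: "catalan_num 0 = 1"
  by (simp add: catalan_num_def)

text \<open>The binomial of 2n + 2 over n + 1 is twice that of 2n + 1 over n, which times n + 1 is
  2n + 1 times the central binomial of 2n.\<close>

lemma catalan_num_Suc: "(real n + 2) * catalan_num (Suc n) = (4 * real n + 2) * catalan_num n"
proof -
  let ?x = "Suc (Suc (2 * n)) choose Suc n" and ?y = "Suc (2 * n) choose n" and ?z = "2 * n choose n"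
  have "Suc n * ?x = Suc n * (2 * ?y)"
    using Suc_times_binomial_eq[of "Suc (2 * n)" n]
    by (simp add: algebra_simps del: binomial_Suc_Suc)
  then have "?x = 2 * ?y"
    by (simp only: mult_cancel1) simp
  moreover have "Suc n * ?y = Suc (2 * n) * ?z"
    using binomial_absorb_comp[of "Suc (2 * n)" n] by (simp add: Suc_diff_le)
  ultimately have "Suc n * ?x = 2 * (Suc (2 * n) * ?z)"
    by (metis mult.left_commute)
  from arg_cong[OF this, of real] have "(real n + 1) * real ?x = (4 * real n + 2) * real ?z"
    by (simp add: algebra_simps)
  then show ?thesis
    by (simp add: catalan_num_def field_simps del: binomial_Suc_Suc)
qed

text \<open>For positive n the coefficient of x^n is the preceding recurrence, shifted to (n + 1)
  C_n = (4n - 2) C_(n-1).\<close>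

lemma catalan_ode:
  "(1 - 4 * fps_X) * (fps_X * fps_deriv catalan_gf) = 1 - (1 - 2 * fps_X) * catalan_gf"
proof (rule fps_ext)
  fix n
  show "((1 - 4 * fps_X) * (fps_X * fps_deriv catalan_gf)) $ n = (1 - (1 - 2 * fps_X) * catalan_gf) $ n"
    using catalan_num_Suc[of "n - 1"]
    by (cases n) (auto simp: catalan_gf_def ring_distribs mult.assoc numeral_fps_const catalan_num_0 of_nat_diff)
qed

text \<open>Comparing coefficients gives (n + 1) T_(n+1) = 4 (n - 1) T_n. Thus T_1 = -4, and the
  factor n - 1 makes T_2 and all later coefficients vanish.\<close>

lemma sqrt_ode_unique:
  assumes "(1 - 4 * fps_X) * fps_deriv T = - 4 * T" "T $ 0 = (1 :: real)"
  shows "T = 1 - 4 * fps_X"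
proof -
  have rec: "real (Suc n) * T $ Suc n = 4 * (real n - 1) * T $ n" for n
    using arg_cong[OF assms(1), of "\<lambda>F. F $ n"]
    by (cases n) (auto simp: ring_distribs mult.assoc numeral_fps_const)
  have "T $ Suc (Suc n) = 0" for n
  proof (induction n)
    case (Suc n)
    then show ?case using rec[of "Suc (Suc n)"] by simp
  qed (use rec[of 1] in simp)
  moreover have "T $ Suc 0 = -4"
    using rec[of 0] assms(2) by simp
  ultimately have "T $ n = (1 - 4 * fps_X) $ n" for n
    using assms(2) by (cases n; cases "n - 1") (auto simp: numeral_fps_const)
  then show ?thesis
    by (simp add: fps_eq_iff)
qed

text \<open>
  With \<open>S = 1 - 2 x C\<close>, the recurrence for the Catalan numbers becomes \<open>(1 - 4 x) S' = -2 S\<close>.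
\<close>

lemma catalan_sqrt_square: "(1 - 2 * fps_X * catalan_gf)\<^sup>2 = 1 - 4 * fps_X"
proof (rule sqrt_ode_unique)
  let ?S = "1 - 2 * fps_X * catalan_gf"
  have dS: "fps_deriv ?S = - 2 * (catalan_gf + fps_X * fps_deriv catalan_gf)"
    by (simp add: algebra_simps)
  have "(1 - 4 * fps_X) * fps_deriv ?S = - 2 * ?S"
    unfolding dS using catalan_ode by algebra
  moreover have "fps_deriv (?S\<^sup>2) = 2 * ?S * fps_deriv ?S"
    by (simp add: power2_eq_square algebra_simps)
  ultimately show "(1 - 4 * fps_X) * fps_deriv (?S\<^sup>2) = - 4 * ?S\<^sup>2"
    by algebra
  show "(?S\<^sup>2) $ 0 = 1"
    by (simp add: power2_eq_square)
qed

text \<open>The series \<open>1 - 2 * fps_X * catalan_gf\<close> has constant coefficient 1, which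
  identifies it among the square roots of \<open>1 - 4 * fps_X\<close>.\<close>

lemma catalan_gf_closed_form:
  "catalan_gf = (1 - fps_radical root 2 (1 - 4 * fps_X)) / (2 * fps_X)"
proof -
  have "1 - 2 * fps_X * catalan_gf = fps_radical root (Suc 1) (1 - 4 * fps_X)"
    using catalan_sqrt_square
    by (subst radical_unique[symmetric]) (auto simp: numeral_2_eq_2)
  then have "1 - fps_radical root 2 (1 - 4 * fps_X) = catalan_gf * (2 * fps_X)"
    by (simp add: numeral_2_eq_2 algebra_simps)
  then show ?thesis
    by simp
qed

text \<open>Expanding the square in \<open>catalan_sqrt_square\<close> and cancelling
  \<open>4 * fps_X\<close> gives the quadratic equation, whose coefficients are the convolution
  recurrence below.\<close>

lemma catalan_gf_eq: "catalan_gf = 1 + fps_X * catalan_gf\<^sup>2"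
proof -
  have "4 * fps_X * catalan_gf = 4 * fps_X * (1 + fps_X * catalan_gf\<^sup>2)"
    using catalan_sqrt_square by algebra
  moreover have "4 * fps_X \<noteq> (0 :: real fps)"
    by simp
  ultimately show ?thesis
    by (simp only: mult_left_cancel not_False_eq_True)
qed

lemma catalan_num_Suc_conv:
  "catalan_num (Suc n) = (\<Sum>i\<le>n. catalan_num i * catalan_num (n - i))"
proof -
  have "catalan_gf $ Suc n = (catalan_gf * catalan_gf) $ n"
    by (subst catalan_gf_eq) (simp add: power2_eq_square)
  then show ?thesis
    by (simp add: catalan_gf_def fps_mult_nth atMost_atLeast0)
qed

section \<open>213-avoiders cut at the letter 1\<close>

lemma subseq_imp_subset: "subseq xs ys \<Longrightarrow> set xs \<subseteq> set ys"
  by (auto elim: list_emb_set)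

text \<open>If x before the minimum \<open>m\<close> were below y after it, then x,
  \<open>m\<close>, y would form a 213. Conversely, an occurrence not inside one side would start in
  \<open>xs\<close> and end at \<open>m\<close> or in \<open>ys\<close> with a larger
  letter.\<close>

lemma avoids_213_append_Cons_iff:
  assumes "\<And>x. x \<in> set (xs @ ys) \<Longrightarrow> m < x" "distinct (xs @ ys)"
  shows "avoids (xs @ m # ys) [2, 1, 3] \<longleftrightarrow>
    avoids xs [2, 1, 3] \<and> avoids ys [2, 1, 3] \<and> (\<forall>x\<in>set xs. \<forall>y\<in>set ys. y < x)"
proof (intro iffI conjI ballI)
  assume L: "avoids (xs @ m # ys) [2, 1, 3]"
  show "avoids xs [2, 1, 3]"
    using L by (rule avoids_subseq) (rule subseq_rev_drop_many, rule subseq_order.refl)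
  show "avoids ys [2, 1, 3]"
    using L by (rule avoids_subseq) (rule subseq_drop_many, rule list_emb_Cons, rule subseq_order.refl)
  fix x y assume xy: "x \<in> set xs" "y \<in> set ys"
  then have "subseq ([x] @ [m, y]) (xs @ m # ys)"
    by (intro list_emb_append_mono) (simp_all add: subseq_singleton_left)
  then have "subseq [x, m, y] (xs @ m # ys)"
    by simp
  moreover have "m < x"
    using assms(1)[of x] xy by simp
  ultimately have "\<not> x < y"
    using L unfolding avoids_213_iff by blast
  moreover have "x \<noteq> y"
    using assms(2) xy by auto
  ultimately show "y < x"
    by simp
next
  assume R: "avoids xs [2, 1, 3] \<and> avoids ys [2, 1, 3] \<and> (\<forall>x\<in>set xs. \<forall>y\<in>set ys. y < x)"
  show "avoids (xs @ m # ys) [2, 1, 3]"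
    unfolding avoids_213_iff
  proof (intro allI impI notI)
    fix a b c assume abc: "subseq [a, b, c] (xs @ m # ys)" "b < a \<and> a < c"
    obtain s1 s2 where s: "[a, b, c] = s1 @ s2" "subseq s1 xs" "subseq s2 (m # ys)"
      using abc(1) by (rule subseq_appendE)
    have sets: "set s1 \<subseteq> set xs" "set s2 \<subseteq> insert m (set ys)"
      using subseq_imp_subset[OF s(2)] subseq_imp_subset[OF s(3)] by simp_all
    consider "s1 = []" "s2 = [a, b, c]" | "a \<in> set s1" "c \<in> set s2" | "s1 = [a, b, c]"
      using s(1) by (auto simp: Cons_eq_append_conv)
    then show False
    proof cases
      case 1
      then have "subseq [a, b, c] (m # ys)" "b \<in> insert m (set ys)"
        using s(3) sets by auto
      moreover from this(2) have "a \<noteq> m"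
        using abc(2) assms(1)[of b] by auto
      ultimately have "subseq [a, b, c] ys"
        using subseq_Cons2_neq[of a "[b, c]" m ys] by simp
      with R abc(2) show False
        unfolding avoids_213_iff by blast
    next
      case 2
      then have "a \<in> set xs" "c = m \<or> c \<in> set ys"
        using sets by auto
      with R abc(2) assms(1)[of a] show False
        by (auto dest: order.asym)
    next
      case 3
      with s(2) R abc(2) show False
        unfolding avoids_213_iff by blast
    qed
  qed
qed

text \<open>For permutations \<open>xs\<close> and \<open>ys\<close>, the part after 1 receives the
  values from 2 to \<open>length ys + 1\<close>, and the part before it all larger values.\<close>

definition join_213 :: "nat list \<Rightarrow> nat list \<Rightarrow> nat list" where
  "join_213 xs ys = map ((+) (Suc (length ys))) xs @ 1 # map Suc ys"

lemma avoiders_213_Suc: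
  "bij_betw (\<lambda>(k, xs, ys). join_213 xs ys)
     (SIGMA k:{..n}. avoiders [2, 1, 3] k \<times> avoiders [2, 1, 3] (n - k))
     (avoiders [2, 1, 3] (Suc n))"
    (is "bij_betw ?f ?D _")
proof (rule bij_betw_imageI)
  show "inj_on ?f ?D"
  proof (rule inj_onI)
    fix z z' assume D: "z \<in> ?D" "z' \<in> ?D" "?f z = ?f z'"
    obtain k xs ys where "z = (k, xs, ys)"
      by (rule prod_cases3)
    moreover obtain k' xs' ys' where "z' = (k', xs', ys')"
      by (rule prod_cases3)
    ultimately have z: "z = (k, xs, ys)" "z' = (k', xs', ys')"
      by blast+
    have *: "xs \<in> permutations_of_set {1..k}" "xs' \<in> permutations_of_set {1..k'}"
      "ys \<in> permutations_of_set {1..n - k}" "ys' \<in> permutations_of_set {1..n - k'}"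
      and eq: "join_213 xs ys = join_213 xs' ys'"
      using D unfolding z by auto
    let ?us = "map ((+) (Suc (length ys))) xs" and ?us' = "map ((+) (Suc (length ys'))) xs'"
    have "0 \<notin> set xs" "0 \<notin> set ys"
      using * by (simp_all add: permutations_of_set_def)
    then have "1 \<notin> set ?us" "1 \<notin> set (map Suc ys)"
      by auto
    then have eqs: "?us = ?us'" "map Suc ys = map Suc ys'"
      using eq append_Cons_eq_iff[of 1 ?us "map Suc ys" ?us' "map Suc ys'"]
      unfolding join_213_def by blast+
    from eqs(2) have "ys = ys'"
      by (rule map_injective) simp
    moreover from this eqs(1) have "map ((+) (Suc (length ys))) xs = map ((+) (Suc (length ys))) xs'"
      by (simp only:)
    then have "xs = xs'"
      by (rule map_injective) (simp add: inj_on_def)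
    moreover from this have "k = k'"
      using *(1,2) length_permutation by blast
    ultimately show "z = z'"
      unfolding z by simp
  qed
  show "?f ` ?D = avoiders [2, 1, 3] (Suc n)"
  proof (intro equalityI subsetI)
    fix p assume "p \<in> ?f ` ?D"
    then obtain k xs ys where k: "k \<le> n" and xs: "xs \<in> avoiders [2, 1, 3] k"
      and ys: "ys \<in> avoiders [2, 1, 3] (n - k)" and p: "p = join_213 xs ys"
      by auto
    let ?xs = "map ((+) (Suc (length ys))) xs" and ?ys = "map Suc ys"
    have len: "length ys = n - k"
      using ys length_permutation by blast
    have "?xs \<in> permutations_of_set {Suc (n - k) + 1..Suc (n - k) + k}"
      unfolding permutations_of_set_shift len using xs by blast
    moreover have "map ((+) 1) ys \<in> permutations_of_set {1 + 1..1 + (n - k)}"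
      unfolding permutations_of_set_shift using ys by blast
    then have "?ys \<in> permutations_of_set {1 + 1..1 + (n - k)}"
      by (simp only: plus_1_eq_Suc)
    ultimately have sets: "set ?xs = {Suc (n - k) + 1..Suc (n - k) + k}" "set ?ys = {1 + 1..1 + (n - k)}"
      and dist: "distinct ?xs" "distinct ?ys"
      by (blast dest: permutations_of_setD)+
    have "distinct (?xs @ ?ys)"
      using dist sets by (simp only: distinct_append) auto
    moreover have "1 < x" if "x \<in> set (?xs @ ?ys)" for x
      using that unfolding set_append sets by auto
    moreover have "\<forall>x\<in>set ?xs. \<forall>y\<in>set ?ys. y < x"
      unfolding sets by auto
    moreover have "avoids ?xs [2, 1, 3]" "avoids ?ys [2, 1, 3]"
      using xs ys by (simp_all only: mem_Collect_eq avoids_map strict_mono_plus_left strict_mono_Suc)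
    ultimately have "avoids p [2, 1, 3]"
      unfolding p join_213_def using avoids_213_append_Cons_iff[of ?xs ?ys 1] by blast
    moreover have "set p = {1..Suc n}"
      unfolding p join_213_def set_append list.set sets using k by auto
    moreover have "distinct p"
      unfolding p join_213_def distinct_append distinct.simps list.set sets using dist by auto
    ultimately show "p \<in> avoiders [2, 1, 3] (Suc n)"
      by (simp add: permutations_of_set_def)
  next
    fix p assume p: "p \<in> avoiders [2, 1, 3] (Suc n)"
    then have "1 \<in> set p"
      by (auto simp: permutations_of_set_def)
    then obtain us vs where uv: "p = us @ 1 # vs"
      using split_list by fast
    have dist: "distinct us" "distinct vs" "set us \<inter> set vs = {}" "1 \<notin> set us" "1 \<notin> set vs"
      and set_p: "set us \<union> set vs = {1..Suc n} - {1}"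
      using p unfolding uv by (auto simp: permutations_of_set_def)
    have avoids: "avoids us [2, 1, 3]" "avoids vs [2, 1, 3]" and less: "\<forall>x\<in>set us. \<forall>y\<in>set vs. y < x"
    proof -
      have "1 < x" if "x \<in> set (us @ vs)" for x
        using that set_p unfolding set_append by auto
      moreover have "distinct (us @ vs)"
        using dist by simp
      ultimately show "avoids us [2, 1, 3]" "avoids vs [2, 1, 3]" "\<forall>x\<in>set us. \<forall>y\<in>set vs. y < x"
        using p avoids_213_append_Cons_iff[of us vs 1] unfolding uv by blast+
    qed
    define k where "k = length us"
    have "card (set us \<union> set vs) = k + length vs"
      using dist by (simp add: card_Un_disjoint k_def distinct_card)
    then have n: "k + length vs = n"
      unfolding set_p by simp
    have vs_subset: "set vs \<subseteq> {1..Suc n} - {1}"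
      using set_p by blast
    \<comment> \<open>Adding 0 and 1 to the values after the letter 1 gives a downward closed set,
      because the values before it are all larger. Its cardinality \<open>2 + (n - k)\<close> then
      determines \<open>set vs\<close>.\<close>
    have lower: "j \<in> {..1} \<union> set vs" if "i \<in> {..1} \<union> set vs" "j \<le> i" for i j
    proof (cases "j \<le> 1")
      case False
      then have i: "i \<in> set vs"
        using that by auto
      with False have "j \<in> set us \<union> set vs"
        unfolding set_p using vs_subset that(2) by auto
      moreover have "j \<notin> set us"
        using i less that(2) by (meson leD)
      ultimately show ?thesis by blast
    qed simp
    have "{..1} \<inter> set vs = {}"
      using vs_subset by auto
    then have card: "card ({..1} \<union> set vs) = 2 + (n - k)"
      using dist n by (subst card_Un_disjoint) (auto simp: distinct_card)
    have union: "{..1} \<union> set vs = {..<2 + (n - k)}"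
      by (rule lower_set_eq_lessThan_card[of "{..1} \<union> set vs", unfolded card]) (simp, rule lower)
    have "set vs = ({..1} \<union> set vs) - {..1}"
      using \<open>{..1} \<inter> set vs = {}\<close> by blast
    also have "\<dots> = {1 + 1..1 + (n - k)}"
      unfolding union by auto
    finally have vs: "set vs = {1 + 1..1 + (n - k)}" .
    have "set us = (set us \<union> set vs) - set vs"
      using dist(3) by blast
    also have "\<dots> = {1..Suc n} - {1} - {1 + 1..1 + (n - k)}"
      unfolding set_p by (simp only: vs)
    also have "\<dots> = {Suc (n - k) + 1..Suc (n - k) + k}"
    proof -
      have "k \<le> n"
        using n by simp
      then show ?thesis by auto
    qed
    finally have us: "set us = {Suc (n - k) + 1..Suc (n - k) + k}" .
    have "us \<in> permutations_of_set {Suc (n - k) + 1..Suc (n - k) + k}"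
      "vs \<in> permutations_of_set {1 + 1..1 + (n - k)}"
      using us vs dist by (simp_all add: permutations_of_set_def)
    then obtain xs ys where xs: "xs \<in> permutations_of_set {1..k}" "us = map ((+) (Suc (n - k))) xs"
      and ys: "ys \<in> permutations_of_set {1..n - k}" "vs = map ((+) 1) ys"
      unfolding permutations_of_set_shift by blast
    have "p = join_213 xs ys"
      unfolding uv join_213_def xs(2) ys(2) length_permutation[OF ys(1)] by simp
    moreover have "(k, xs, ys) \<in> ?D"
      using xs ys avoids n unfolding xs(2) ys(2) avoids_map[OF strict_mono_plus_left] by simp
    ultimately show "p \<in> ?f ` ?D"
      by (intro image_eqI[of _ _ "(k, xs, ys)"]) simp_all
  qed
qed

text \<open>Cutting at the letter 1 gives the counts the same convolution recurrence and initial
  value as the Catalan numbers.\<close>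

lemma card_avoiders_213: "real (card (avoiders [2, 1, 3] n)) = catalan_num n"
proof (induction n rule: less_induct)
  case (less n)
  show ?case
  proof (cases n)
    case 0
    have "avoids [] [2, 1, 3]"
      by (rule avoids_Nil) simp
    then have "avoiders [2, 1, 3] 0 = {[]}"
      by auto
    then show ?thesis
      by (simp add: 0 catalan_num_0)
  next
    case (Suc m)
    have "card (avoiders [2, 1, 3] (Suc m)) =
        card (SIGMA k:{..m}. avoiders [2, 1, 3] k \<times> avoiders [2, 1, 3] (m - k))"
      using avoiders_213_Suc[of m] by (rule bij_betw_same_card[symmetric])
    also have "\<dots> = (\<Sum>k\<le>m. card (avoiders [2, 1, 3] k) * card (avoiders [2, 1, 3] (m - k)))"
      by (subst card_SigmaI) (auto simp: card_cartesian_product)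
    finally have "real (card (avoiders [2, 1, 3] n)) =
        (\<Sum>k\<le>m. real (card (avoiders [2, 1, 3] k)) * real (card (avoiders [2, 1, 3] (m - k))))"
      unfolding Suc by simp
    also have "\<dots> = (\<Sum>k\<le>m. catalan_num k * catalan_num (m - k))"
      using less Suc by (intro sum.cong refl arg_cong2[where f = "(*)"]) auto
    finally show ?thesis
      by (simp only: Suc catalan_num_Suc_conv)
  qed
qed

section \<open>The generating functions\<close>

text \<open>Here \<open>fps_X\<close> is the variable q of the coefficient ring. Writing the
  coefficients as sums of powers of q makes the weighted decompositions applicable.\<close>

lemma descent_polynomial:
  assumes "finite S"
  shows "Abs_fps (\<lambda>i. of_nat (card {p \<in> S. num_descents p = i})) =
    (\<Sum>p\<in>S. fps_X ^ num_descents p :: real fps)"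
proof (rule fps_ext)
  fix i
  have "(\<Sum>p\<in>S. fps_X ^ num_descents p :: real fps) $ i = (\<Sum>p\<in>S. if num_descents p = i then 1 else 0)"
    by (simp add: fps_sum_nth eq_commute)
  also have "\<dots> = of_nat (card {p \<in> S. num_descents p = i})"
    using sum.inter_filter[OF assms, of "\<lambda>_. 1 :: real" "\<lambda>p. num_descents p = i"] by simp
  finally show "Abs_fps (\<lambda>i. of_nat (card {p \<in> S. num_descents p = i})) $ i =
      (\<Sum>p\<in>S. fps_X ^ num_descents p :: real fps) $ i"
    by simp
qed

lemma A_gf_nth:
  "A_gf \<sigma> $ n = (if n = 0 then 1 else \<Sum>p\<in>avoiders \<sigma> n. fps_X ^ num_descents p)"
proof -
  have "Abs_fps (\<lambda>i. of_nat (A_num \<sigma> n i)) = (\<Sum>p\<in>avoiders \<sigma> n. fps_X ^ num_descents p :: real fps)"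
    by (subst descent_polynomial[symmetric]) (simp_all add: A_num_def conj_assoc)
  then show ?thesis
    by (simp add: A_gf_def)
qed

lemma I_gf_nth:
  "I_gf \<sigma> $ n = (if n = 0 then 0 else \<Sum>p\<in>indecomposable_avoiders \<sigma> n. fps_X ^ num_descents p)"
proof -
  have "Abs_fps (\<lambda>i. of_nat (I_num \<sigma> n i)) =
      (\<Sum>p\<in>indecomposable_avoiders \<sigma> n. fps_X ^ num_descents p :: real fps)"
    by (subst descent_polynomial[symmetric]) (simp_all add: I_num_def conj_assoc)
  then show ?thesis
    by (simp add: I_gf_def)
qed

text \<open>The coefficient of x^m is q^(m-1), the weight of the decreasing permutation of length m.
  The coefficients are power series in q, so the inverse of the denominator is obtained as a right
  inverse from its constant coefficient 1.\<close>

lemma geometric_series_xq: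
  "var_x / (1 - var_x * var_q) = Abs_fps (\<lambda>m. if m = 0 then 0 else fps_X ^ (m - 1))"
proof -
  let ?D = "1 - var_x * var_q" and ?G = "Abs_fps (\<lambda>m. if m = 0 then 0 else fps_X ^ (m - 1)) :: real fps fps"
  have D0: "?D $ 0 = 1"
    by simp
  have "inverse ?D = fps_right_inverse ?D (inverse (?D $ 0))"
    by (rule fps_inverse_def)
  then have "inverse ?D = fps_right_inverse ?D 1"
    by (simp only: D0 fps_inverse_one)
  moreover have "?D * fps_right_inverse ?D 1 = 1"
    by (rule fps_right_inverse) simp
  ultimately have inverse: "?D * inverse ?D = 1"
    by (simp only:)
  have G: "?D * ?G = var_x"
  proof (rule fps_ext)
    fix n
    have "(?D * ?G) $ n = ?G $ n - (if n = 0 then 0 else fps_X * ?G $ (n - 1))"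
      by (simp only: left_diff_distrib mult_1_left fps_sub_nth mult.assoc fps_X_mult_nth fps_mult_left_const_nth)
    also have "\<dots> = var_x $ n"
    proof -
      consider "n = 0" | "n = 1" | m where "n = Suc (Suc m)"
        by (metis One_nat_def not0_implies_Suc)
      then show ?thesis
        by cases simp_all
    qed
    finally show "(?D * ?G) $ n = var_x $ n" .
  qed
  have "?G = ?G * (?D * inverse ?D)"
    by (simp only: inverse mult_1_right)
  also have "\<dots> = ?D * ?G * inverse ?D"
    by (simp only: mult_ac)
  also have "\<dots> = var_x * inverse ?D"
    by (simp only: G)
  finally have "?G = var_x * inverse ?D" .
  moreover have "var_x / ?D = var_x * inverse ?D"
    by (rule fps_divide_unit) (simp add: D0)
  ultimately show ?thesis
    by simp
qed

text \<open>From n = 2 on, the three sums of \<open>sum_avoiders_2134\<close> are the coefficients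
  of the three nonconstant summands; n = 0 and n = 1 are checked directly.\<close>

theorem A_gf_2134:
  "A_gf [2, 1, 3, 4] = 1 + I_gf [2, 1, 3, 4] + var_x * (A_gf [2, 1, 3, 4] - 1)
     + var_x / (1 - var_x * var_q) * (I_gf [2, 1, 3] - var_x)"
  unfolding geometric_series_xq
proof (rule fps_ext)
  fix n
  let ?\<tau> = "[2, 1, 3, 4] :: nat list" and ?\<sigma> = "[2, 1, 3] :: nat list"
  let ?G = "Abs_fps (\<lambda>m. if m = 0 then 0 else fps_X ^ (m - 1)) :: real fps fps"
  let ?q = "\<lambda>p. fps_X ^ num_descents p :: real fps"
  \<comment> \<open>Subtracting x removes the indecomposable permutation \<open>[1]\<close>, whose
    direct sums are already counted by \<open>var_x * (A_gf ?\<tau> - 1)\<close>.\<close>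
  define H where "H = I_gf ?\<sigma> - var_x"
  have H: "H $ k = (if k < 2 then 0 else I_gf ?\<sigma> $ k)" for k
  proof -
    have "I_gf ?\<sigma> $ 1 = 1"
      unfolding I_gf_nth by (subst indecomposable_avoiders_1) simp_all
    then show ?thesis
      unfolding H_def by (cases k; cases "k - 1") (auto simp: I_gf_nth fps_X_def)
  qed
  have GH: "(?G * H) $ n = (\<Sum>k=2..n-1. I_gf ?\<sigma> $ k * fps_X ^ (n - k - 1))"
  proof -
    have "(?G * H) $ n = (\<Sum>k=0..n. H $ k * ?G $ (n - k))"
      by (subst mult.commute) (rule fps_mult_nth)
    also have "\<dots> = (\<Sum>k=2..n-1. H $ k * ?G $ (n - k))"
      \<comment> \<open>\<open>H\<close> vanishes below degree 2 and \<open>?G\<close> at degree 0,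
        which leaves \<open>k\<close> from 2 to \<open>n - 1\<close>.\<close>
      by (rule sum.mono_neutral_right) (auto simp: H)
    also have "\<dots> = (\<Sum>k=2..n-1. I_gf ?\<sigma> $ k * fps_X ^ (n - k - 1))"
      by (rule sum.cong) (auto simp: H)
    finally show ?thesis .
  qed
  consider "n = 0" | "n = 1" | "2 \<le> n"
    by linarith
  then have "A_gf ?\<tau> $ n = (1 + I_gf ?\<tau> + var_x * (A_gf ?\<tau> - 1) + ?G * H) $ n"
  proof cases
    case 1
    then show ?thesis
      using GH by (simp add: A_gf_nth I_gf_nth)
  next
    case 2
    have "A_gf ?\<tau> $ 1 = 1" "I_gf ?\<tau> $ 1 = 1"
      unfolding A_gf_nth I_gf_nth by (subst avoiders_1 indecomposable_avoiders_1; simp)+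
    then show ?thesis
      using GH unfolding 2 by (simp add: A_gf_nth)
  next
    case 3
    have one: "[1] \<in> permutations_of_set {1..1 :: nat}"
      by simp
    have "A_gf ?\<tau> $ n = (\<Sum>p\<in>avoiders ?\<tau> n. ?q p)"
      using 3 by (simp add: A_gf_nth)
    also have "\<dots> = (\<Sum>p\<in>indecomposable_avoiders ?\<tau> n. ?q p) +
      (\<Sum>\<tau>\<in>avoiders ?\<tau> (n - 1). ?q (direct_sum [1] \<tau>)) +
      (\<Sum>k=2..n-1. \<Sum>\<sigma>\<in>indecomposable_avoiders ?\<sigma> k. ?q (direct_sum \<sigma> (rev [1..<Suc (n - k)])))"
      by (rule sum_avoiders_2134[OF 3])
    also have "(\<Sum>p\<in>indecomposable_avoiders ?\<tau> n. ?q p) = I_gf ?\<tau> $ n"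
      using 3 by (simp add: I_gf_nth)
    also have "(\<Sum>\<tau>\<in>avoiders ?\<tau> (n - 1). ?q (direct_sum [1] \<tau>)) = (\<Sum>\<tau>\<in>avoiders ?\<tau> (n - 1). ?q \<tau>)"
    proof (rule sum.cong[OF refl])
      fix \<tau> assume "\<tau> \<in> avoiders ?\<tau> (n - 1)"
      then show "?q (direct_sum [1] \<tau>) = ?q \<tau>"
        using num_descents_direct_sum[OF one, of \<tau> "n - 1"] by simp
    qed
    also have "\<dots> = (var_x * (A_gf ?\<tau> - 1)) $ n"
      using 3 by (simp add: A_gf_nth)
    also have "(\<Sum>k=2..n-1. \<Sum>\<sigma>\<in>indecomposable_avoiders ?\<sigma> k. ?q (direct_sum \<sigma> (rev [1..<Suc (n - k)]))) =
      (?G * H) $ n"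
      unfolding GH
    proof (rule sum.cong[OF refl])
      fix k assume k: "k \<in> {2..n-1}"
      have dec: "rev [1..<Suc (n - k)] \<in> permutations_of_set {1..n - k}"
        by (intro permutations_of_setI) (auto simp del: upt_Suc)
      have "(\<Sum>\<sigma>\<in>indecomposable_avoiders ?\<sigma> k. ?q (direct_sum \<sigma> (rev [1..<Suc (n - k)]))) =
        (\<Sum>\<sigma>\<in>indecomposable_avoiders ?\<sigma> k. ?q \<sigma> * fps_X ^ (n - k - 1))"
      proof (rule sum.cong[OF refl])
        fix \<sigma> assume "\<sigma> \<in> indecomposable_avoiders ?\<sigma> k"
        then show "?q (direct_sum \<sigma> (rev [1..<Suc (n - k)])) = ?q \<sigma> * fps_X ^ (n - k - 1)"
          using num_descents_direct_sum[OF _ dec, of \<sigma> k] num_descents_rev_upt[of "n - k"]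
          by (simp only: mem_Collect_eq power_add)
      qed
      also have "\<dots> = I_gf ?\<sigma> $ k * fps_X ^ (n - k - 1)"
        using k by (simp add: I_gf_nth sum_distrib_right)
      finally show "(\<Sum>\<sigma>\<in>indecomposable_avoiders ?\<sigma> k. ?q (direct_sum \<sigma> (rev [1..<Suc (n - k)]))) =
        I_gf ?\<sigma> $ k * fps_X ^ (n - k - 1)" .
    qed
    finally show ?thesis
      using 3 by simp
  qed
  then show "A_gf ?\<tau> $ n = (1 + I_gf ?\<tau> + var_x * (A_gf ?\<tau> - 1) + ?G * (I_gf ?\<sigma> - var_x)) $ n"
    unfolding H_def .
qed

lemma I_tot_1: "2 \<le> length \<sigma> \<Longrightarrow> I_tot \<sigma> 1 = 1"
  unfolding I_tot_eq_card by (subst indecomposable_avoiders_1) simp_all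

lemma card_avoiders_213_recurrence:
  assumes "2 \<le> n"
  shows "card (avoiders [2, 1, 3] n) = I_tot [2, 1, 3] n + card (avoiders [2, 1, 3] (n - 1))"
  using sum_avoiders_213[OF assms, of "\<lambda>_. 1 :: nat"] unfolding I_tot_eq_card card_eq_sum .

lemma card_avoiders_2134_recurrence:
  assumes "2 \<le> n"
  shows "card (avoiders [2, 1, 3, 4] n) = I_tot [2, 1, 3, 4] n +
    card (avoiders [2, 1, 3, 4] (n - 1)) + (\<Sum>k=2..n-1. I_tot [2, 1, 3] k)"
  using sum_avoiders_2134[OF assms, of "\<lambda>_. 1 :: nat"] unfolding I_tot_eq_card card_eq_sum .

lemma catalan_num_1: "catalan_num 1 = 1"
  by (simp add: catalan_num_def)

text \<open>The 213-recurrence makes each summand C_k - C_(k-1), so the sum telescopes down to C_1 =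
  1.\<close>

lemma sum_I_tot_213:
  assumes "1 \<le> m"
  shows "(\<Sum>k=2..m. real (I_tot [2, 1, 3] k)) = catalan_num m - 1"
  using assms
proof (induction m rule: dec_induct)
  case base
  show ?case
    unfolding catalan_num_1 by simp
next
  case (step m)
  then have "2 \<le> Suc m"
    by simp
  from arg_cong[OF card_avoiders_213_recurrence[OF this], of real]
  have "catalan_num (Suc m) = real (I_tot [2, 1, 3] (Suc m)) + catalan_num m"
    by (simp only: of_nat_add card_avoiders_213 diff_Suc_1)
  moreover have "(\<Sum>k=2..Suc m. real (I_tot [2, 1, 3] k)) =
      real (I_tot [2, 1, 3] (Suc m)) + (\<Sum>k=2..m. real (I_tot [2, 1, 3] k))"
    using \<open>2 \<le> Suc m\<close> by (rule sum.nat_ivl_Suc')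
  ultimately show ?case
    using step.IH by linarith
qed

text \<open>The Wilf equivalence replaces the 2134-counts by \<open>E_num\<close>, and the
  telescoped sum supplies \<open>- catalan_num (n - 1) + 1\<close>.\<close>

lemma I_tot_2134:
  assumes "2 \<le> n"
  shows "real (I_tot [2, 1, 3, 4] n) = real (E_num n) - real (E_num (n - 1)) - catalan_num (n - 1) + 1"
proof -
  have "real (E_num n) = real (I_tot [2, 1, 3, 4] n) + real (E_num (n - 1)) +
      (\<Sum>k=2..n-1. real (I_tot [2, 1, 3] k))"
    using arg_cong[OF card_avoiders_2134_recurrence[OF assms], of real]
    by (simp only: card_avoiders_2134_eq_E_num of_nat_add of_nat_sum)
  then show ?thesis
    using sum_I_tot_213[of "n - 1"] assms by simp
qed

lemma E_num_0_1: "E_num 0 = 1" "E_num 1 = 1"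
proof -
  have "{p \<in> permutations_of_set {1..0}. avoids p [1, 2, 3, 4]} = {[]}"
    using avoids_Nil[of "[1, 2, 3, 4]"] by auto
  then show "E_num 0 = 1"
    unfolding E_num_def by simp
  show "E_num 1 = 1"
    unfolding E_num_def by (subst avoiders_1) simp_all
qed

text \<open>The quotient supplies the constant 1 of the coefficient formula for n at least 2, while
  -1 and 2x adjust the coefficients at n = 0 and n = 1.\<close>

lemma I_gf1_2134:
  "I_gf1 [2, 1, 3, 4] =
     (1 - fps_X) * E_gf - fps_X * catalan_gf - 1 + 2 * fps_X + fps_X ^ 2 / (1 - fps_X)"
proof -
  let ?G = "Abs_fps (\<lambda>n. if n < 2 then 0 else 1 :: real)"
  have square: "fps_X\<^sup>2 = ?G * (1 - fps_X)"
  proof (rule fps_ext)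
    fix n show "(fps_X\<^sup>2 :: real fps) $ n = (?G * (1 - fps_X)) $ n"
      by (auto simp: right_diff_distrib)
  qed
  have "(1 - fps_X :: real fps) $ 0 \<noteq> 0 $ 0"
    by simp
  then have "1 - fps_X \<noteq> (0 :: real fps)"
    by metis
  then have G: "fps_X\<^sup>2 / (1 - fps_X) = ?G"
    unfolding square by (rule nonzero_mult_div_cancel_right)
  show ?thesis
    unfolding G
  proof (rule fps_ext)
    fix n :: nat
    consider "n = 0" | "n = 1" | "2 \<le> n"
      by linarith
    then show "I_gf1 [2, 1, 3, 4] $ n =
        ((1 - fps_X) * E_gf - fps_X * catalan_gf - 1 + 2 * fps_X + ?G) $ n"
    proof cases
      case 1
      then show ?thesis
        by (simp add: I_gf1_def E_gf_def E_num_0_1)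
    next
      case 2
      then show ?thesis
        using I_tot_1[of "[2, 1, 3, 4]"] E_num_0_1
        by (simp add: I_gf1_def E_gf_def catalan_gf_def catalan_num_0 left_diff_distrib numeral_fps_const)
    next
      case 3
      then show ?thesis
        using I_tot_2134[OF 3]
        by (simp add: I_gf1_def E_gf_def catalan_gf_def left_diff_distrib numeral_fps_const)
    qed
  qed
qed

theorem theorem3p15:
  shows "A_gf [2, 1, 3, 4] =
           1 + I_gf [2, 1, 3, 4] + var_x * (A_gf [2, 1, 3, 4] - 1)
             + var_x / (1 - var_x * var_q) * (I_gf [2, 1, 3] - var_x)
       \<and> catalan_gf = (1 - fps_radical root 2 (1 - 4 * fps_X)) / (2 * fps_X)
       \<and> I_gf1 [2, 1, 3, 4] =
           (1 - fps_X) * E_gf - fps_X * catalan_gf - 1 + 2 * fps_X + fps_X ^ 2 / (1 - fps_X)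
       \<and> I_tot [2, 1, 3, 4] 1 = 1
       \<and> (\<forall>n \<ge> 2. real (I_tot [2, 1, 3, 4] n) =
             real (E_num n) - real (E_num (n - 1)) - catalan_num (n - 1) + 1)"
  by (intro conjI allI impI)
    (rule A_gf_2134, rule catalan_gf_closed_form, rule I_gf1_2134, rule I_tot_1, simp, rule I_tot_2134)

end
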